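(* Let $0<p<\infty$, let $\mathcal S$ be an $\eta$-sparse collection of cubes in $\mathbb R^n$, and let $v,w$ be weights on $\mathbb R^n$. Suppose that there exists $0<\varepsilon\leq1$ such that $\varepsilon<p$, $wv^{-\varepsilon}\in A_\infty$, and $$[v^{-\varepsilon}]_{RH_\infty(w)}:=\sup_Q\frac{w(Q)}{wv^{-\varepsilon}(Q)}\,\Vert\chi_Qv^{-\varepsilon}\Vert_{L^\infty(w)}<\infty,$$ where the supremum is over all cubes $Q$. Then there exists a constant $C>0$, independent of $\mathcal S$ (though possibly depending on $\eta$), such that the inequality $$\left\Vert\frac{\mathcal A_{\mathcal S}(\vec f)}{v}\right\Vert_{L^{p,\infty}(w)}\leq C\left\Vert\frac{\mathcal M(\vec f)}{v}\right\Vert_{L^{p,\infty}(w)}$$ holds for every vector of measurable functions $\vec f=(f_1,\dots,f_m)$ on $\mathbb R^n$.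
   Context: A weight is a positive, locally integrable function on $\mathbb R^n$. Cubes have sides parallel to the axes. For a weight $w$ and a measurable set $E$, $w(E)=\int_E w(x)\,dx$; similarly $wv^{-\varepsilon}(Q)=\int_Q wv^{-\varepsilon}$. We write $\Vert f\Vert_{L^{p,\infty}(w)}=\sup_{y>0} y\,w(\{x:|f(x)|>y\})^{1/p}$. $A_\infty=\bigcup_{q\ge1}A_q$, where $A_q$ denotes the Muckenhoupt classes. A collection of cubes $\mathcal S$ is $\eta$-sparse, with $0<\eta<1$, if for every $Q\in\mathcal S$ there is a measurable set $E_Q\subseteq Q$ with $\eta|Q|\leq|E_Q|$, and $E_Q\cap E_R=\emptyset$ for all $Q\neq R$ in $\mathcal S$. The associated sparse operator is $$\mathcal A_{\mathcal S}(\vec f)=\sum_{Q\in\mathcal S}\left(\prod_{i=1}^m\frac1{|Q|}\int_Qf_i\right)\chi_Q,$$ and the multi(sub)linear maximal operator is $\mathcal M(\vec f)=\sup_Q\left(\prod_{i=1}^m\frac1{|Q|}\int_Q|f_i|\right)\chi_Q$, the supremum being over all cubes. As usual, the inequality is understood for $\vec f$ for which the expressions make sense. *)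

theory Defs
  imports "HOL-Probability.Essential_Supremum"
begin

text \<open>Each side is a bounded interval of length \<open>l\<close>, which may contain both, one or none of its
  endpoints.\<close>

definition is_cube :: "(real^'n) set \<Rightarrow> bool" where
  "is_cube Q \<longleftrightarrow>
    (\<exists>a l I. 0 < l \<and>
      (\<forall>i. {a $ i<..<a $ i + l} \<subseteq> I i \<and> I i \<subseteq> {a $ i..a $ i + l}) \<and>
      Q = {x. \<forall>i. x $ i \<in> I i})"

definition weight :: "(real^'n \<Rightarrow> real) \<Rightarrow> bool" where
  "weight w \<longleftrightarrow>
    w \<in> borel_measurable lebesgue \<and> (\<forall>x. 0 < w x) \<and>
    (\<forall>K. compact K \<longrightarrow> set_integrable lebesgue K w)"

definition wmeas :: "(real^'n \<Rightarrow> real) \<Rightarrow> (real^'n) set \<Rightarrow> ennreal" where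
  "wmeas w E = (\<integral>\<^sup>+x\<in>E. ennreal (w x) \<partial>lebesgue)"

text \<open>Real powers on \<open>[0, \<infinity>]\<close>; only used for exponents \<open>r > 0\<close>.\<close>

definition enn_powr :: "ennreal \<Rightarrow> real \<Rightarrow> ennreal" where
  "enn_powr a r = (if a = top then top else ennreal (enn2real a powr r))"

text \<open>For \<open>q > 1\<close> with conjugate exponent \<open>q'\<close> one has \<open>1 - q' = - 1 / (q - 1)\<close>, so the condition is
  \<open>sup\<^sub>Q (avg\<^sub>Q u) (avg\<^sub>Q u\<^bsup>1 - q'\<^esup>)\<^bsup>q - 1\<^esup> < \<infinity>\<close>.  The class is empty for \<open>q < 1\<close>.\<close>

definition muckenhoupt :: "real \<Rightarrow> (real^'n \<Rightarrow> real) \<Rightarrow> bool" where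
  "muckenhoupt q u \<longleftrightarrow> weight u \<and>
    (if q = 1 then
       \<exists>C. \<forall>Q. is_cube Q \<longrightarrow>
         (AE x in lebesgue. x \<in> Q \<longrightarrow> wmeas u Q / emeasure lebesgue Q \<le> ennreal (C * u x))
     else 1 < q \<and>
       (SUP Q\<in>{Q. is_cube Q}.
          wmeas u Q / emeasure lebesgue Q *
          enn_powr (wmeas (\<lambda>x. u x powr (- 1 / (q - 1))) Q / emeasure lebesgue Q) (q - 1)) < top)"

definition muckenhoupt_infinity :: "(real^'n \<Rightarrow> real) \<Rightarrow> bool" where
  "muckenhoupt_infinity u \<longleftrightarrow> (\<exists>q\<ge>1. muckenhoupt q u)"

text \<open>The constant \<open>[g]\<close> of \<open>RH\<^sub>\<infinity>(w)\<close>, with values in \<open>[0, \<infinity>]\<close>.  The essential supremum is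
  taken with respect to the measure \<open>w dx\<close>.\<close>

definition RH_infinity_const :: "(real^'n \<Rightarrow> real) \<Rightarrow> (real^'n \<Rightarrow> real) \<Rightarrow> ennreal" where
  "RH_infinity_const w g =
    (SUP Q\<in>{Q. is_cube Q}.
       wmeas w Q / wmeas (\<lambda>x. w x * g x) Q *
       esssup (density lebesgue (\<lambda>x. ennreal (w x))) (\<lambda>x. ennreal (indicator Q x * \<bar>g x\<bar>)))"

definition weak_Lp_norm :: "real \<Rightarrow> (real^'n \<Rightarrow> real) \<Rightarrow> (real^'n \<Rightarrow> ereal) \<Rightarrow> ennreal" where
  "weak_Lp_norm p w g =
    (SUP y\<in>{0<..}. ennreal y * enn_powr (wmeas w {x. ereal y < \<bar>g x\<bar>}) (1 / p))"

definition sparse_family :: "real \<Rightarrow> (real^'n) set set \<Rightarrow> bool" where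
  "sparse_family \<eta> S \<longleftrightarrow>
    (\<forall>Q\<in>S. is_cube Q) \<and>
    (\<exists>E. (\<forall>Q\<in>S. E Q \<in> sets lebesgue \<and> E Q \<subseteq> Q \<and> \<eta> * measure lebesgue Q \<le> measure lebesgue (E Q)) \<and>
         disjoint_family_on E S)"

text \<open>Integral and unordered sum of functions of arbitrary sign, as the difference of the
  contributions of the positive and the negative part.  This is meaningful, possibly with an
  infinite value, when one of the two is finite, in particular for non-negative functions.
  Note that \<open>ennreal\<close> and \<open>e2ennreal\<close> map negative numbers to \<open>0\<close>.\<close>

definition has_cube_avg :: "(real^'n \<Rightarrow> real) \<Rightarrow> (real^'n) set \<Rightarrow> bool" where
  "has_cube_avg f Q \<longleftrightarrow>
    (\<integral>\<^sup>+x\<in>Q. ennreal (f x) \<partial>lebesgue) < top \<or> (\<integral>\<^sup>+x\<in>Q. ennreal (- f x) \<partial>lebesgue) < top"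

definition cube_avg :: "(real^'n \<Rightarrow> real) \<Rightarrow> (real^'n) set \<Rightarrow> ereal" where
  "cube_avg f Q =
    (enn2ereal (\<integral>\<^sup>+x\<in>Q. ennreal (f x) \<partial>lebesgue) - enn2ereal (\<integral>\<^sup>+x\<in>Q. ennreal (- f x) \<partial>lebesgue))
      / ereal (measure lebesgue Q)"

definition has_ereal_sum :: "('a \<Rightarrow> ereal) \<Rightarrow> 'a set \<Rightarrow> bool" where
  "has_ereal_sum t S \<longleftrightarrow>
    (\<Sum>\<^sub>\<infinity>Q\<in>S. e2ennreal (t Q)) < top \<or> (\<Sum>\<^sub>\<infinity>Q\<in>S. e2ennreal (- t Q)) < top"

definition ereal_sum :: "('a \<Rightarrow> ereal) \<Rightarrow> 'a set \<Rightarrow> ereal" where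
  "ereal_sum t S =
    enn2ereal (\<Sum>\<^sub>\<infinity>Q\<in>S. e2ennreal (t Q)) - enn2ereal (\<Sum>\<^sub>\<infinity>Q\<in>S. e2ennreal (- t Q))"

text \<open>The vector of functions is \<open>(f 0, \<dots>, f (m - 1))\<close>; products use \<open>0 * \<infinity> = 0\<close>.\<close>

definition sparse_term ::
    "nat \<Rightarrow> (nat \<Rightarrow> real^'n \<Rightarrow> real) \<Rightarrow> real^'n \<Rightarrow> (real^'n) set \<Rightarrow> ereal" where
  "sparse_term m f x Q = (\<Prod>i<m. cube_avg (f i) Q) * indicator Q x"

definition sparse_operator ::
    "nat \<Rightarrow> (real^'n) set set \<Rightarrow> (nat \<Rightarrow> real^'n \<Rightarrow> real) \<Rightarrow> real^'n \<Rightarrow> ereal" where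
  "sparse_operator m S f x = ereal_sum (sparse_term m f x) S"

definition sparse_operator_defined ::
    "nat \<Rightarrow> (real^'n) set set \<Rightarrow> (nat \<Rightarrow> real^'n \<Rightarrow> real) \<Rightarrow> bool" where
  "sparse_operator_defined m S f \<longleftrightarrow>
    (\<forall>Q\<in>S. \<forall>i<m. has_cube_avg (f i) Q) \<and>
    (AE x in lebesgue. has_ereal_sum (sparse_term m f x) S)"

definition maximal_operator ::
    "nat \<Rightarrow> (nat \<Rightarrow> real^'n \<Rightarrow> real) \<Rightarrow> real^'n \<Rightarrow> ereal" where
  "maximal_operator m f x =
    (SUP Q\<in>{Q. is_cube Q}. (\<Prod>i<m. cube_avg (\<lambda>z. \<bar>f i z\<bar>) Q) * indicator Q x)"

end

theory Submission
  imports Defs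
begin

text \<open>Put \<open>u = w v\<^bsup>-\<epsilon>\<^esup>\<close> and let \<open>b Q\<close> be the product of the averages of \<open>\<bar>f i\<bar>\<close> over \<open>Q\<close>.  The sparse operator is
  dominated by the sum of \<open>b Q\<close> over the cubes \<open>Q \<ni> x\<close>, the maximal operator dominates each
  single \<open>b Q\<close> on \<open>Q\<close>.  The power \<open>\<epsilon>\<close> serves two purposes: since \<open>\<epsilon> \<le> 1\<close>, the power of the sum is at most
  the sum of the powers, and since \<open>\<epsilon> < p\<close>, the power of a function in weak \<open>L\<^sup>p(w)\<close> lies in weak \<open>L\<^sup>q(w)\<close>
  with \<open>q = p / \<epsilon> > 1\<close>, where a function can be integrated over sets of finite measure.

  Two facts about the weights carry the proof.  By \<open>A\<^sub>\<infinity>\<close>, \<open>u(Q) \<le> C u(E)\<close> whenever \<open>E\<close> fills a fixed fraction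
  of the cube \<open>Q\<close> (\<open>muckenhoupt_infinity_comparable\<close>); this applies to the disjoint sets \<open>E Q\<close> provided by
  sparseness and to a cube inside its triple.  By \<open>RH\<^sub>\<infinity>(w)\<close>, \<open>w(Q) u(F) \<le> K u(Q) w(F)\<close> for all \<open>F \<subseteq> Q\<close>
  (\<open>RH_infinity_comparable\<close>).  Together they show that \<open>w\<close> is doubling, so that the maximal operator of
  the measure \<open>w dx\<close> is of weak type \<open>(1,1)\<close> (\<open>doubling_covering\<close>), and that
  \<open>u(Q \<inter> X) \<le> C u(E Q) w(Q \<inter> X) / w(Q)\<close> for every \<open>X\<close>.

  Take for \<open>X\<close> the set where the sum exceeds \<open>y v\<close>.  Then
  \<open>y\<^sup>\<epsilon> w(X) \<le> \<Sum> (b Q)\<^sup>\<epsilon> u(Q \<inter> X) \<le> C \<Sum> (b Q)\<^sup>\<epsilon> u(E Q) w(Q \<inter> X) / w(Q)\<close>.  As the sets \<open>E Q\<close> are disjoint, the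
  last sum is at most the \<open>w\<close>-integral of the \<open>\<epsilon>\<close>-th power of the maximal operator divided by \<open>v\<close>, times
  the maximal function of the indicator of \<open>X\<close>.  Splitting the cubes according to the size of
  \<open>w(Q \<inter> X) / w(Q)\<close> bounds this integral by a small multiple of \<open>y\<^sup>\<epsilon> w(X)\<close>, to be absorbed, plus the wanted
  quantity (\<open>sparse_sum_weak_type\<close>).  This takes the place of the duality between Lorentz spaces.

  For the absorption \<open>w(X)\<close> has to be finite.  So the estimate is proved for finite subfamilies, with
  constants that do not depend on the subfamily; a sparse family is countable, and monotone convergence
  concludes (\<open>finite_families_suffice\<close>).\<close>

section \<open>A weak type estimate for sparse sums in a measure space\<close>

lemma powr_sum_subadditive:
  fixes a :: "'b \<Rightarrow> real"
  assumes "finite A" "\<And>i. i \<in> A \<Longrightarrow> 0 \<le> a i" "0 < e" "e \<le> 1"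
  shows "(\<Sum>i\<in>A. a i) powr e \<le> (\<Sum>i\<in>A. a i powr e)"
proof (cases "(\<Sum>i\<in>A. a i) = 0")
  case True
  then show ?thesis by (simp add: sum_nonneg)
next
  case False
  define s where "s = (\<Sum>i\<in>A. a i)"
  have s: "s > 0" using False assms(2) by (simp add: s_def order_less_le sum_nonneg)
  have *: "a i / s * s powr e \<le> a i powr e" if "i \<in> A" for i
  proof -
    have "a i \<le> s" unfolding s_def by (rule member_le_sum) (use assms that in auto)
    then have "(a i / s) powr 1 \<le> (a i / s) powr e"
      using assms that s by (intro powr_mono') auto
    then have "a i / s \<le> a i powr e / s powr e"
      using assms(2)[OF that] s by (simp add: powr_divide)
    then show ?thesis using s by (simp add: field_simps)
  qed
  have "s powr e = (\<Sum>i\<in>A. a i / s * s powr e)"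
    using s by (simp add: s_def[symmetric] sum_distrib_right[symmetric] sum_divide_distrib[symmetric])
  also have "\<dots> \<le> (\<Sum>i\<in>A. a i powr e)" by (intro sum_mono *)
  finally show ?thesis by (simp add: s_def)
qed

lemma powr_less_iff_nonneg:
  fixes a b e :: real
  assumes "0 \<le> a" "0 \<le> b" "0 < e"
  shows "a powr e < b powr e \<longleftrightarrow> a < b"
  using assms powr_less_mono2[of e a b] powr_mono2[of e b a] by (auto simp: not_less[symmetric])

text \<open>Kolmogorov's inequality in additive form.  Cutting \<open>h\<close> at the levels \<open>2\<^sup>j t\<close> turns the tail bound into a
  geometric series, which converges because \<open>q > 1\<close>.  The threshold \<open>t\<close> is left free instead of being
  optimised to get \<open>C B\<^bsup>1/q\<^esup> M(G)\<^bsup>1 - 1/q\<^esup>\<close>: it will be chosen scale by scale, and then no fractional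
  power of the measure of \<open>G\<close> ever appears.\<close>

lemma nn_integral_le_of_weak_tail:
  fixes h :: "'a \<Rightarrow> real"
  assumes [measurable]: "h \<in> borel_measurable M" "G \<in> sets M"
    and h: "\<And>x. 0 \<le> h x" and t: "0 < t" and q: "1 < q" and B: "0 \<le> B"
    and tail: "\<And>s. 0 < s \<Longrightarrow> emeasure M {x\<in>space M. s < h x} \<le> ennreal (B * s powr - q)"
  shows "(\<integral>\<^sup>+x\<in>G. ennreal (h x) \<partial>M)
    \<le> ennreal t * emeasure M G + ennreal (2 / (1 - 2 powr (1 - q)) * B * t powr (1 - q))"
proof -
  let ?L = "\<lambda>j::nat. {x\<in>space M. 2 ^ j * t < h x}"
  have pw: "ennreal (h x) \<le> ennreal t + (\<Sum>j. ennreal (2 ^ Suc j * t) * indicator (?L j) x)"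
    if x: "x \<in> space M" for x
  proof (cases "h x \<le> t")
    case True
    then show ?thesis by (simp add: ennreal_leI add_increasing2)
  next
    case False
    \<comment> \<open>the last level below \<open>h x\<close>: its term of the series alone dominates \<open>h x\<close>\<close>
    obtain N where N: "h x / t < 2 ^ N" using real_arch_pow[of 2 "h x / t"] by auto
    define P where "P j \<longleftrightarrow> h x \<le> 2 ^ j * t" for j :: nat
    have "P N" using N t by (simp add: P_def field_simps)
    moreover have "\<not> P 0" using False by (simp add: P_def)
    ultimately obtain j where j: "\<not> P j" "P (Suc j)"
      using dec_induct[of 0 N "\<lambda>j. \<not> P j"] by blast
    have "ennreal (h x) \<le> ennreal (2 ^ Suc j * t) * indicator (?L j) x"
      using j x by (auto simp: P_def not_le intro!: ennreal_leI)
    also have "\<dots> \<le> (\<Sum>j. ennreal (2 ^ Suc j * t) * indicator (?L j) x)"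
      using sum_le_suminf[of "\<lambda>j. ennreal (2 ^ Suc j * t) * indicator (?L j) x" "{j}"]
      by (simp del: sum_mult_indicator sum_indicator_mult)
    finally show ?thesis by (simp add: add_increasing)
  qed
  have geo: "(\<lambda>j. 2 * B * t powr (1 - q) * (2 powr (1 - q)) ^ j) sums
      (2 * B * t powr (1 - q) * (1 / (1 - 2 powr (1 - q))))"
    using q by (intro sums_mult geometric_sums) (simp add: powr_less_one)
  have layer: "ennreal (2 ^ Suc j * t) * emeasure M (?L j)
      \<le> ennreal (2 * B * t powr (1 - q) * (2 powr (1 - q)) ^ j)" for j
  proof -
    have "ennreal (2 ^ Suc j * t) * emeasure M (?L j)
        \<le> ennreal (2 ^ Suc j * t) * ennreal (B * (2 ^ j * t) powr - q)"
      using t by (intro mult_left_mono tail) auto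
    also have "\<dots> = ennreal (2 * B * ((2 ^ j * t) * (2 ^ j * t) powr - q))"
      using t B by (simp add: ennreal_mult[symmetric] mult_ac)
    also have "(2 ^ j * t) * (2 ^ j * t) powr - q = (2 ^ j * t) powr (1 - q)"
      using t by (simp add: powr_diff powr_minus field_simps)
    also have "\<dots> = t powr (1 - q) * (2 powr (1 - q)) ^ j"
      using t by (simp add: powr_mult powr_powr powr_realpow[symmetric] mult_ac)
    finally show ?thesis by (simp add: mult_ac)
  qed
  have "(\<integral>\<^sup>+x\<in>G. ennreal (h x) \<partial>M)
      \<le> (\<integral>\<^sup>+x. ennreal t * indicator G x + (\<Sum>j. ennreal (2 ^ Suc j * t) * indicator (?L j) x) \<partial>M)"
    by (intro nn_integral_mono) (use pw in \<open>auto simp: indicator_def\<close>)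
  also have "\<dots> = ennreal t * emeasure M G + (\<Sum>j. ennreal (2 ^ Suc j * t) * emeasure M (?L j))"
    by (subst nn_integral_add) (auto simp: nn_integral_suminf nn_integral_cmult_indicator)
  also have "(\<Sum>j. ennreal (2 ^ Suc j * t) * emeasure M (?L j))
      \<le> (\<Sum>j. ennreal (2 * B * t powr (1 - q) * (2 powr (1 - q)) ^ j))"
    by (intro suminf_le layer) auto
  also have "\<dots> = ennreal (2 * B * t powr (1 - q) * (1 / (1 - 2 powr (1 - q))))"
    using B by (intro suminf_ennreal_eq geo) auto
  finally show ?thesis by (simp add: field_simps add_left_mono)
qed

text \<open>The constant that results from the choice of \<open>\<theta>\<close> in \<open>sparse_sum_weak_type\<close>; there \<open>s\<close> sums the scales of the
  cubes and \<open>c\<close> is the constant of Kolmogorov's inequality.\<close>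

definition absorption_const :: "real \<Rightarrow> real \<Rightarrow> real \<Rightarrow> real" where
  "absorption_const q K D =
    (let s = 1 / (1 - 2 powr (- 1 / q)); c = 2 / (1 - 2 powr (1 - q))
     in 2 * K * s * c * (1 / (4 * K * D * s)) powr (1 - q))"

lemma absorption_const_pos:
  assumes "1 < q" "0 < K" "0 < D"
  shows "0 < absorption_const q K D"
proof -
  have "2 powr (- 1 / q) < 1" "2 powr (1 - q) < 1"
    using assms by (auto intro!: powr_less_one divide_neg_pos)
  then show ?thesis using assms by (simp add: absorption_const_def Let_def)
qed

text \<open>The heart of the matter, for a finite family \<open>S\<close>.  Write \<open>g\<close> for the largest \<open>b Q\<close> with \<open>x \<in> Q\<close>, so that
  \<open>tail\<close> says that \<open>g / v\<close> is in weak \<open>L\<^sup>p\<close>, and \<open>h = (g / v)\<^sup>\<epsilon>\<close>, which is in weak \<open>L\<^sup>q\<close> for \<open>q = p / \<epsilon> > 1\<close>.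

  On \<open>X\<close> the sum exceeds \<open>y v\<close>; raising to the power \<open>\<epsilon> \<le> 1\<close> and integrating gives
  \<open>y\<^sup>\<epsilon> M(X) \<le> \<Sum> (b Q)\<^sup>\<epsilon> \<nu>(Q \<inter> X)\<close>, and \<open>carleson\<close> bounds \<open>\<nu>(Q \<inter> X)\<close> by \<open>K r(Q) \<nu>(E Q)\<close>, where
  \<open>r(Q) = M(Q \<inter> X) / M(Q)\<close>.  The cubes with \<open>r(Q) \<approx> 2\<^bsup>-j\<^esup>\<close> have disjoint sets \<open>E Q\<close>, hence contribute at most
  \<open>K 2\<^bsup>-j\<^esup>\<close> times the integral of \<open>h\<close> over their union, whose measure is at most \<open>2\<^bsup>j+1\<^esup> D M(X)\<close> by
  \<open>covering\<close>.  Kolmogorov's inequality with threshold \<open>t\<^sub>j\<close> makes this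
  \<open>K (2 D t\<^sub>j M(X) + c B 2\<^bsup>-j\<^esup> t\<^sub>j\<^bsup>1-q\<^esup>)\<close>.  With \<open>t\<^sub>j = \<theta> y\<^sup>\<epsilon> 2\<^bsup>-j/q\<^esup>\<close> both terms decay like \<open>2\<^bsup>-j/q\<^esup>\<close>, and for \<open>\<theta>\<close> small
  the first one sums to half of \<open>y\<^sup>\<epsilon> M(X)\<close>.  It is absorbed on the left, which is legitimate because \<open>M(X)\<close>
  is finite.\<close>

lemma sparse_sum_weak_type:
  fixes M :: "'a measure" and v :: "'a \<Rightarrow> real" and b :: "'a set \<Rightarrow> real"
    and S :: "'a set set" and E :: "'a set \<Rightarrow> 'a set" and p \<epsilon> K D B y :: real
  defines "\<nu> \<equiv> \<lambda>F. (\<integral>\<^sup>+x\<in>F. ennreal (v x powr - \<epsilon>) \<partial>M)"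
  defines "X \<equiv> {x\<in>space M. y * v x < (\<Sum>Q\<in>S. b Q * indicator Q x)}"
  assumes par: "0 < \<epsilon>" "\<epsilon> \<le> 1" "\<epsilon> < p" "0 < K" "0 < D" "0 \<le> B" "0 < y"
    and v [measurable]: "v \<in> borel_measurable M" and vpos: "\<And>x. 0 < v x"
    and fin: "finite S" and bpos: "\<And>Q. Q \<in> S \<Longrightarrow> 0 \<le> b Q"
    and S: "\<And>Q. Q \<in> S \<Longrightarrow> Q \<in> sets M" "\<And>Q. Q \<in> S \<Longrightarrow> 0 < emeasure M Q"
      "\<And>Q. Q \<in> S \<Longrightarrow> emeasure M Q < top"
    and E: "\<And>Q. Q \<in> S \<Longrightarrow> E Q \<in> sets M" "\<And>Q. Q \<in> S \<Longrightarrow> E Q \<subseteq> Q" "disjoint_family_on E S"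
    and carleson: "\<And>Q F. Q \<in> S \<Longrightarrow> F \<in> sets M \<Longrightarrow> F \<subseteq> Q \<Longrightarrow>
      emeasure M Q * \<nu> F \<le> ennreal K * \<nu> (E Q) * emeasure M F"
    and covering: "\<And>T Y t. T \<subseteq> S \<Longrightarrow> Y \<in> sets M \<Longrightarrow> 0 < t \<Longrightarrow>
      (\<And>Q. Q \<in> T \<Longrightarrow> ennreal t * emeasure M Q \<le> emeasure M (Q \<inter> Y)) \<Longrightarrow>
      ennreal t * emeasure M (\<Union>T) \<le> ennreal D * emeasure M Y"
    and tail: "\<And>s. 0 < s \<Longrightarrow>
      emeasure M {x\<in>space M. \<exists>Q\<in>S. x \<in> Q \<and> s * v x < b Q} \<le> ennreal (B * s powr - p)"
  shows "ennreal (y powr p) * emeasure M X \<le> ennreal (absorption_const (p / \<epsilon>) K D * B)"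
proof (cases "S = {}")
  case True
  have "\<not> y * v x < 0" for x
    using par vpos[of x] by (simp add: not_less)
  then show ?thesis by (simp add: X_def True)
next
  case False
  note [measurable] = S(1) E(1)
  have [measurable]: "X \<in> sets M" unfolding X_def using fin by measurable
  have XS: "X \<subseteq> \<Union>S"
  proof
    fix x assume "x \<in> X"
    then have "0 < (\<Sum>Q\<in>S. b Q * indicator Q x)"
      using par vpos[of x] by (auto simp: X_def intro: less_trans[rotated])
    then have "(\<Sum>Q\<in>S. b Q * indicator Q x) \<noteq> 0" by simp
    then obtain Q where "Q \<in> S" "b Q * indicator Q x \<noteq> 0" by (rule sum.not_neutral_contains_not_neutral)
    then show "x \<in> \<Union>S" by (auto simp: indicator_def split: if_splits)
  qed
  have Xfin: "emeasure M X < top"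
  proof -
    have "emeasure M X \<le> emeasure M (\<Union>S)" using XS fin by (intro emeasure_mono) auto
    also have "\<dots> \<le> (\<Sum>Q\<in>S. emeasure M Q)"
      using emeasure_subadditive_finite[OF fin, of "\<lambda>Q. Q" M] S by (auto simp: subset_eq)
    also have "\<dots> < top" using S fin by (simp add: ennreal_sum_less_top)
    finally show ?thesis .
  qed
  define m where "m = measure M X"
  have m: "emeasure M X = ennreal m" "0 \<le> m"
    using Xfin by (simp_all add: m_def emeasure_eq_ennreal_measure)
  define q where "q = p / \<epsilon>"
  have q: "1 < q" "0 < q" using par by (auto simp: q_def)
  define s where "s = 1 / (1 - 2 powr (- 1 / q))"
  define c where "c = 2 / (1 - 2 powr (1 - q))"
  \<comment> \<open>so small that the terms with \<open>M(X)\<close> add up to half of the left-hand side\<close>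
  define \<theta> where "\<theta> = 1 / (4 * K * D * s)"
  have "2 powr (- 1 / q) < 1" "2 powr (1 - q) < 1"
    using q by (auto intro!: powr_less_one divide_neg_pos)
  then have sc: "0 < s" "0 < c" by (auto simp: s_def c_def)
  have \<theta>: "0 < \<theta>" using sc par by (simp add: \<theta>_def)
  define f where "f Q x = b Q powr \<epsilon> * indicator Q x * v x powr - \<epsilon>" for Q x
  define h where "h x = Max ((\<lambda>Q. f Q x) ` S)" for x
  have f0: "0 \<le> f Q x" for Q x by (simp add: f_def)
  have fh: "f Q x \<le> h x" if "Q \<in> S" for Q x
    using that fin by (auto simp: h_def)
  have h0: "0 \<le> h x" for x
    using fh f0 False by (meson all_not_in_conv order_trans)
  have [measurable]: "h \<in> borel_measurable M"
    unfolding h_def f_def using fin by (intro borel_measurable_Max) auto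
  have htail: "emeasure M {x\<in>space M. u < h x} \<le> ennreal (B * u powr - q)" if u: "0 < u" for u
  proof -
    have "{x\<in>space M. u < h x} = {x\<in>space M. \<exists>Q\<in>S. x \<in> Q \<and> u powr (1/\<epsilon>) * v x < b Q}"
    proof -
      have "u < f Q x \<longleftrightarrow> x \<in> Q \<and> u powr (1/\<epsilon>) * v x < b Q" if "Q \<in> S" for Q x
      proof (cases "x \<in> Q")
        case False
        then show ?thesis using u by (simp add: f_def)
      next
        case True
        have "u < f Q x \<longleftrightarrow> u * v x powr \<epsilon> < b Q powr \<epsilon>"
          using True vpos[of x] by (simp add: f_def powr_minus_divide pos_less_divide_eq)
        also have "u * v x powr \<epsilon> = (u powr (1/\<epsilon>) * v x) powr \<epsilon>"
          using u vpos[of x] par by (simp add: powr_mult powr_powr)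
        also have "\<dots> < b Q powr \<epsilon> \<longleftrightarrow> u powr (1/\<epsilon>) * v x < b Q"
          using vpos[of x] par bpos[OF that] by (intro powr_less_iff_nonneg) auto
        finally show ?thesis using True by simp
      qed
      moreover have "u < h x \<longleftrightarrow> (\<exists>Q\<in>S. u < f Q x)" for x
        using fin False by (simp add: h_def Max_gr_iff)
      ultimately show ?thesis by (intro Collect_cong conj_cong refl) (simp cong: bex_cong)
    qed
    also have "emeasure M \<dots> \<le> ennreal (B * (u powr (1/\<epsilon>)) powr - p)"
      using u by (intro tail) auto
    also have "(u powr (1/\<epsilon>)) powr - p = u powr - q"
      using par by (simp add: powr_powr q_def)
    finally show ?thesis .
  qed
  define r where "r Q = measure M (Q \<inter> X) / measure M Q" for Q
  define S' where "S' = {Q\<in>S. 0 < r Q}"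
  \<comment> \<open>\<open>k Q\<close> is the dyadic scale of \<open>r Q\<close>: \<open>2\<^bsup>-k-1\<^esup> \<le> r \<le> 2\<^bsup>-k\<^esup>\<close>\<close>
  define k where "k Q = nat \<lfloor>- log 2 (r Q)\<rfloor>" for Q
  have S'S: "S' \<subseteq> S" and finS': "finite S'" using fin by (auto simp: S'_def)
  have mQ: "emeasure M Q = ennreal (measure M Q)" "0 < measure M Q" if "Q \<in> S" for Q
  proof -
    show *: "emeasure M Q = ennreal (measure M Q)"
      using S(3)[OF that] by (simp add: emeasure_eq_ennreal_measure)
    show "0 < measure M Q" using S(2)[OF that] unfolding * by simp
  qed
  have mQX: "emeasure M (Q \<inter> X) = ennreal (r Q * measure M Q)" "r Q \<le> 1" if "Q \<in> S" for Q
  proof -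
    have "emeasure M (Q \<inter> X) \<le> emeasure M Q" using S(1)[OF that] by (intro emeasure_mono) auto
    then have "emeasure M (Q \<inter> X) \<noteq> top" using S(3)[OF that] by auto
    then show "emeasure M (Q \<inter> X) = ennreal (r Q * measure M Q)"
      using mQ[OF that] by (simp add: r_def emeasure_eq_ennreal_measure)
    have "measure M (Q \<inter> X) \<le> measure M Q"
      using S[OF that] by (intro measure_mono_fmeasurable) (auto simp: fmeasurable_def)
    then show "r Q \<le> 1" using mQ[OF that] by (simp add: r_def)
  qed
  have k: "r Q \<le> 2 powr - real (k Q)" "2 powr - real (Suc (k Q)) \<le> r Q" if "Q \<in> S'" for Q
  proof -
    have r: "0 < r Q" "r Q \<le> 1" using that mQX by (auto simp: S'_def)
    then have "0 \<le> - log 2 (r Q)" by simp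
    then have "real (k Q) \<le> - log 2 (r Q)" "- log 2 (r Q) \<le> real (Suc (k Q))"
      unfolding k_def by linarith+
    then have "2 powr log 2 (r Q) \<le> 2 powr - real (k Q)"
        "2 powr - real (Suc (k Q)) \<le> 2 powr log 2 (r Q)"
      by (intro powr_mono; linarith)+
    then show "r Q \<le> 2 powr - real (k Q)" "2 powr - real (Suc (k Q)) \<le> r Q"
      using r by (simp_all del: of_nat_Suc)
  qed
  have step: "\<nu> (Q \<inter> X) \<le> ennreal (K * r Q) * \<nu> (E Q)" if "Q \<in> S" for Q
  proof -
    have "emeasure M Q * \<nu> (Q \<inter> X) \<le> ennreal K * \<nu> (E Q) * emeasure M (Q \<inter> X)"
      using that by (intro carleson) auto
    also have "\<dots> = emeasure M Q * (ennreal (K * r Q) * \<nu> (E Q))"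
    proof -
      have "0 \<le> r Q" by (simp add: r_def)
      then have "ennreal (r Q * measure M Q) = ennreal (r Q) * emeasure M Q"
          "ennreal (K * r Q) = ennreal K * ennreal (r Q)"
        using par mQ[OF that] by (simp_all add: ennreal_mult)
      then show ?thesis unfolding mQX(1)[OF that] by (simp only: mult_ac)
    qed
    finally show ?thesis
      using S[OF that] by (subst (asm) ennreal_mult_le_mult_iff) auto
  qed
  define t where "t j = \<theta> * y powr \<epsilon> * 2 powr (- real j / q)" for j :: nat
  have t: "0 < t j" for j using \<theta> par by (simp add: t_def)
  define R where "R = 2 * D * \<theta> * y powr \<epsilon> * m + c * B * \<theta> powr (1 - q) * y powr (\<epsilon> - p)"
  have R: "0 \<le> R" using par sc \<theta> m by (simp add: R_def)
  have layer: "(\<Sum>Q\<in>{Q\<in>S'. k Q = j}. ennreal (b Q powr \<epsilon>) * \<nu> (Q \<inter> X))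
      \<le> ennreal (K * R * 2 powr (- real j / q))" (is "?l \<le> _") for j
  proof -
    define T where "T = {Q\<in>S'. k Q = j}"
    have TS: "T \<subseteq> S" and finT: "finite T" using S'S finS' by (auto simp: T_def)
    define w where "w = 2 powr - real j"
    have w: "0 < w" "2 powr - real (Suc j) = w / 2"
      by (auto simp: w_def powr_diff powr_minus powr_add field_simps)
    have "?l \<le> (\<Sum>Q\<in>T. ennreal (K * w) * (ennreal (b Q powr \<epsilon>) * \<nu> (E Q)))"
      unfolding T_def[symmetric]
    proof (rule sum_mono)
      fix Q assume Q: "Q \<in> T"
      have "\<nu> (Q \<inter> X) \<le> ennreal (K * r Q) * \<nu> (E Q)" using Q TS by (intro step) auto
      also have "\<dots> \<le> ennreal (K * w) * \<nu> (E Q)"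
        using k(1)[of Q] Q par by (intro mult_right_mono ennreal_leI) (auto simp: T_def w_def)
      finally show "ennreal (b Q powr \<epsilon>) * \<nu> (Q \<inter> X)
          \<le> ennreal (K * w) * (ennreal (b Q powr \<epsilon>) * \<nu> (E Q))"
        by (metis mult.left_commute mult_left_mono zero_le)
    qed
    also have "\<dots> = ennreal (K * w) * (\<Sum>Q\<in>T. ennreal (b Q powr \<epsilon>) * \<nu> (E Q))"
      by (simp add: sum_distrib_left)
    \<comment> \<open>at each point at most one \<open>E Q\<close> is active, and there \<open>(b Q / v)\<^sup>\<epsilon> \<le> h\<close>\<close>
    also have "(\<Sum>Q\<in>T. ennreal (b Q powr \<epsilon>) * \<nu> (E Q))
        = (\<integral>\<^sup>+x. (\<Sum>Q\<in>T. ennreal (b Q powr \<epsilon>) * (ennreal (v x powr - \<epsilon>) * indicator (E Q) x)) \<partial>M)"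
      unfolding \<nu>_def using TS by (subst nn_integral_sum) (auto simp: nn_integral_cmult subset_eq)
    also have "\<dots> \<le> (\<integral>\<^sup>+x\<in>\<Union>T. ennreal (h x) \<partial>M)"
    proof (intro nn_integral_mono)
      fix x
      show "(\<Sum>Q\<in>T. ennreal (b Q powr \<epsilon>) * (ennreal (v x powr - \<epsilon>) * indicator (E Q) x))
          \<le> ennreal (h x) * indicator (\<Union>T) x"
      proof (cases "\<exists>Q\<in>T. x \<in> E Q")
        case False
        then have "(\<Sum>Q\<in>T. ennreal (b Q powr \<epsilon>) * (ennreal (v x powr - \<epsilon>) * indicator (E Q) x)) = 0"
          by (intro sum.neutral) auto
        then show ?thesis by simp
      next
        case True
        then obtain P where P: "P \<in> T" "x \<in> E P" by auto
        then have "x \<notin> E Q" if "Q \<in> T" "Q \<noteq> P" for Q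
          using E(3) that TS by (auto simp: disjoint_family_on_def)
        then have "(\<Sum>Q\<in>T. ennreal (b Q powr \<epsilon>) * (ennreal (v x powr - \<epsilon>) * indicator (E Q) x))
            = (\<Sum>Q\<in>{P}. ennreal (b Q powr \<epsilon>) * (ennreal (v x powr - \<epsilon>) * indicator (E Q) x))"
          using P finT by (intro sum.mono_neutral_right) auto
        also have "\<dots> = ennreal (f P x)"
        proof -
          have "x \<in> P" using P E(2)[of P] TS by auto
          then show ?thesis using P by (simp add: f_def ennreal_mult[symmetric])
        qed
        also have "\<dots> \<le> ennreal (h x)" using fh P TS by (auto intro!: ennreal_leI)
        also have "\<dots> = ennreal (h x) * indicator (\<Union>T) x"
        proof -
          have "x \<in> \<Union>T" using P E(2)[of P] TS by blast
          then show ?thesis by (simp del: Union_iff)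
        qed
        finally show ?thesis .
      qed
    qed
    also have "\<dots> \<le> ennreal (t j) * emeasure M (\<Union>T)
        + ennreal (2 / (1 - 2 powr (1 - q)) * B * t j powr (1 - q))"
    proof (rule nn_integral_le_of_weak_tail)
      show "\<Union>T \<in> sets M" using TS finT S(1) by (intro sets.finite_Union) auto
    qed (use h0 t q par htail in auto)
    finally have "?l \<le> ennreal (K * w) * (ennreal (t j) * emeasure M (\<Union>T)
        + ennreal (c * B * t j powr (1 - q)))"
      by (simp add: c_def mult_left_mono)
    also have "\<dots> = ennreal (2 * K * t j) * (ennreal (w / 2) * emeasure M (\<Union>T))
        + ennreal (K * w * (c * B * t j powr (1 - q)))"
    proof -
      have e: "ennreal (K * w) = ennreal (2 * K) * ennreal (w / 2)"
          "ennreal (2 * K * t j) = ennreal (2 * K) * ennreal (t j)"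
        using par w t[of j] by (simp_all flip: ennreal_mult)
      have "ennreal (K * w) * (ennreal (t j) * Z) = ennreal (2 * K * t j) * (ennreal (w / 2) * Z)" for Z
        unfolding e by (simp only: mult_ac)
      moreover have "ennreal (K * w * (c * B * t j powr (1 - q)))
          = ennreal (K * w) * ennreal (c * B * t j powr (1 - q))"
        using par w sc by (intro ennreal_mult) auto
      ultimately show ?thesis by (simp only: distrib_left)
    qed
    also have "\<dots> \<le> ennreal (2 * K * t j) * (ennreal D * emeasure M X)
        + ennreal (K * w * (c * B * t j powr (1 - q)))"
    proof (intro add_right_mono mult_left_mono covering)
      show "ennreal (w / 2) * emeasure M Q \<le> emeasure M (Q \<inter> X)" if "Q \<in> T" for Q
      proof -
        have "Q \<in> S" "w / 2 \<le> r Q" using that TS k(2)[of Q] w(2) by (auto simp: T_def)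
        then show ?thesis using mQ[of Q] mQX[of Q] w
          by (auto simp: ennreal_mult[symmetric] intro!: ennreal_leI)
      qed
    qed (use TS w in auto)
    also have "\<dots> = ennreal (K * (2 * D * t j * m + c * B * (w * t j powr (1 - q))))"
      using par m w t[of j] sc
      by (simp add: ennreal_mult[symmetric] ennreal_plus[symmetric] algebra_simps del: ennreal_plus)
    also have "w * t j powr (1 - q) = \<theta> powr (1 - q) * y powr (\<epsilon> - p) * 2 powr (- real j / q)"
    proof -
      have "\<epsilon> * (1 - q) = \<epsilon> - p" using par by (simp add: q_def field_simps)
      moreover have "- real j + (- real j / q) * (1 - q) = - real j / q"
        using q by (simp add: field_simps)
      ultimately show ?thesis
        using \<theta> par by (simp add: t_def w_def powr_mult powr_powr powr_add[symmetric] mult_ac)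
    qed
    also have "K * (2 * D * t j * m + c * B * (\<theta> powr (1 - q) * y powr (\<epsilon> - p) * 2 powr (- real j / q)))
        = K * R * 2 powr (- real j / q)"
      by (simp add: R_def t_def algebra_simps)
    finally show ?thesis .
  qed
  have "ennreal (y powr \<epsilon> * m) = (\<integral>\<^sup>+x\<in>X. ennreal (y powr \<epsilon>) \<partial>M)"
    by (simp add: nn_integral_cmult_indicator ennreal_mult m)
  also have "\<dots> \<le> (\<integral>\<^sup>+x. (\<Sum>Q\<in>S. ennreal (b Q powr \<epsilon>) * (ennreal (v x powr - \<epsilon>) * indicator (Q \<inter> X) x)) \<partial>M)"
  proof (intro nn_integral_mono)
    fix x
    show "ennreal (y powr \<epsilon>) * indicator X x \<le>
        (\<Sum>Q\<in>S. ennreal (b Q powr \<epsilon>) * (ennreal (v x powr - \<epsilon>) * indicator (Q \<inter> X) x))"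
    proof (cases "x \<in> X")
      case True
      have "(y * v x) powr \<epsilon> \<le> (\<Sum>Q\<in>S. b Q * indicator Q x) powr \<epsilon>"
        using True par vpos[of x] by (intro powr_mono2) (auto simp: X_def)
      also have "\<dots> \<le> (\<Sum>Q\<in>S. (b Q * indicator Q x) powr \<epsilon>)"
        using fin bpos par by (intro powr_sum_subadditive) auto
      also have "\<dots> = (\<Sum>Q\<in>S. b Q powr \<epsilon> * indicator Q x)"
        by (intro sum.cong) (auto simp: indicator_def)
      finally have "y powr \<epsilon> \<le> (\<Sum>Q\<in>S. b Q powr \<epsilon> * indicator Q x) * v x powr - \<epsilon>"
        using par vpos[of x] by (simp add: powr_mult powr_minus field_simps)
      also have "\<dots> = (\<Sum>Q\<in>S. b Q powr \<epsilon> * (v x powr - \<epsilon> * indicator (Q \<inter> X) x))"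
        unfolding sum_distrib_right using True by (intro sum.cong) (auto simp: indicator_def)
      finally have "ennreal (y powr \<epsilon>)
          \<le> ennreal (\<Sum>Q\<in>S. b Q powr \<epsilon> * (v x powr - \<epsilon> * indicator (Q \<inter> X) x))"
        by (rule ennreal_leI)
      also have "\<dots> = (\<Sum>Q\<in>S. ennreal (b Q powr \<epsilon>) * (ennreal (v x powr - \<epsilon>) * indicator (Q \<inter> X) x))"
        by (subst sum_ennreal[symmetric]) (auto simp: ennreal_mult ennreal_indicator)
      finally show ?thesis using True by simp
    qed simp
  qed
  also have "\<dots> = (\<Sum>Q\<in>S. ennreal (b Q powr \<epsilon>) * \<nu> (Q \<inter> X))"
    unfolding \<nu>_def by (subst nn_integral_sum) (auto simp: nn_integral_cmult)
  also have "\<dots> = (\<Sum>Q\<in>S'. ennreal (b Q powr \<epsilon>) * \<nu> (Q \<inter> X))"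
  proof (rule sum.mono_neutral_right[OF fin S'S], rule ballI)
    fix Q assume "Q \<in> S - S'"
    then have Q: "Q \<in> S" "r Q \<le> 0" by (auto simp: S'_def)
    have "K * r Q \<le> 0" using Q par by (simp add: mult_nonneg_nonpos)
    then show "ennreal (b Q powr \<epsilon>) * \<nu> (Q \<inter> X) = 0"
      using step[OF Q(1)] by (simp add: ennreal_neg)
  qed
  also have "\<dots> = (\<Sum>j\<in>k ` S'. \<Sum>Q\<in>{Q\<in>S'. k Q = j}. ennreal (b Q powr \<epsilon>) * \<nu> (Q \<inter> X))"
    by (rule sum.image_gen[OF finS'])
  also have "\<dots> \<le> (\<Sum>j\<in>k ` S'. ennreal (K * R * 2 powr (- real j / q)))"
    by (intro sum_mono layer)
  also have "\<dots> = ennreal (\<Sum>j\<in>k ` S'. K * R * 2 powr (- real j / q))"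
    using par R by (intro sum_ennreal) auto
  also have "\<dots> \<le> ennreal (K * R * s)"
  proof (rule ennreal_leI)
    have geo: "(\<lambda>j. K * R * (2 powr (- 1 / q)) ^ j) sums (K * R * s)"
      unfolding s_def using \<open>2 powr (- 1 / q) < 1\<close> by (intro sums_mult geometric_sums) auto
    have eq: "2 powr (- real j / q) = (2 powr (- 1 / q)) ^ j" for j
      by (simp add: powr_realpow[symmetric] powr_powr)
    show "(\<Sum>j\<in>k ` S'. K * R * 2 powr (- real j / q)) \<le> K * R * s"
      unfolding eq using par R finS'
      by (subst sums_unique[OF geo]) (intro sum_le_suminf sums_summable[OF geo], auto)
  qed
  finally have "y powr \<epsilon> * m \<le> K * R * s"
    using par R sc by (subst (asm) ennreal_le_iff) auto
  also have "\<dots> = (4 * K * D * s * \<theta>) * (y powr \<epsilon> * m) / 2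
      + K * s * c * B * \<theta> powr (1 - q) * y powr (\<epsilon> - p)"
    by (simp add: R_def algebra_simps)
  also have "4 * K * D * s * \<theta> = 1" using par sc by (simp add: \<theta>_def)
  finally have "y powr \<epsilon> * m \<le> 2 * K * s * c * \<theta> powr (1 - q) * B * y powr (\<epsilon> - p)"
    by (simp add: mult_ac)
  also have "2 * K * s * c * \<theta> powr (1 - q) = absorption_const q K D"
    by (simp add: absorption_const_def Let_def s_def c_def \<theta>_def)
  also have "y powr (\<epsilon> - p) = y powr \<epsilon> / y powr p" by (simp add: powr_diff)
  finally have "y powr p * m \<le> absorption_const q K D * B"
    using par by (simp add: field_simps)
  then show ?thesis using m by (simp add: ennreal_mult[symmetric] q_def ennreal_leI)
qed

section \<open>Cubes and Lebesgue measure\<close>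

text \<open>A cube is known up to its boundary only.  Everything below uses just the two boxes between which it
  lies; they differ by a null set.\<close>

lemma is_cube_between_boxes:
  fixes Q :: "(real^'n) set"
  assumes "is_cube Q"
  obtains a l where "0 < l" "box a (\<chi> i. a $ i + l) \<subseteq> Q" "Q \<subseteq> cbox a (\<chi> i. a $ i + l)"
proof -
  from assms obtain a l I where *: "0 < l"
      "\<And>i. {a $ i<..<a $ i + l} \<subseteq> I i" "\<And>i. I i \<subseteq> {a $ i..a $ i + l}"
      "Q = {x. \<forall>i. x $ i \<in> I i}"
    unfolding is_cube_def by blast
  show ?thesis
  proof (rule that)
    show "box a (\<chi> i. a $ i + l) \<subseteq> Q"
    proof
      fix x assume "x \<in> box a (\<chi> i. a $ i + l)"
      then have "x $ i \<in> {a $ i<..<a $ i + l}" for i by (simp add: mem_box_cart)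
      then show "x \<in> Q" using *(2) *(4) by blast
    qed
    show "Q \<subseteq> cbox a (\<chi> i. a $ i + l)"
    proof
      fix x assume "x \<in> Q"
      then have "x $ i \<in> {a $ i..a $ i + l}" for i using *(3,4) by blast
      then show "x \<in> cbox a (\<chi> i. a $ i + l)" by (simp add: mem_box_cart)
    qed
  qed (rule *(1))
qed

lemma is_cube_cbox: "is_cube (cbox a (\<chi> i. a $ i + l))" if "0 < l"
  unfolding is_cube_def
  by (rule exI[of _ a], rule exI[of _ l], rule exI[of _ "\<lambda>i. {a $ i..a $ i + l}"])
    (use that in \<open>auto simp: mem_box_cart\<close>)

lemma between_boxes_lebesgue:
  fixes Q :: "(real^'n) set"
  assumes "0 < l" and Q: "box a (\<chi> i. a $ i + l) \<subseteq> Q" "Q \<subseteq> cbox a (\<chi> i. a $ i + l)"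
  shows "Q \<in> sets lebesgue" "emeasure lebesgue Q = ennreal (l ^ CARD('n))"
    "measure lebesgue Q = l ^ CARD('n)"
proof -
  let ?c = "cbox a (\<chi> i. a $ i + l)" and ?b = "box a (\<chi> i. a $ i + l)"
  have null: "Q - ?b \<in> null_sets lebesgue" "?c - Q \<in> null_sets lebesgue"
    unfolding negligible_iff_null_sets[symmetric] using Q
    by (auto intro: negligible_subset[OF negligible_frontier_interval])
  have "Q = ?b \<union> (Q - ?b)" using Q by auto
  then show sets: "Q \<in> sets lebesgue"
    using sets.Un[OF _ null_setsD2[OF null(1)], of ?b] by simp
  have "?c = Q \<union> (?c - Q)" using Q by auto
  then have "emeasure lebesgue Q = emeasure lebesgue ?c"
    using emeasure_Un_null_set[OF sets null(2)] by simp
  also have "\<dots> = emeasure lborel ?c" by simp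
  also have "\<dots> = ennreal (measure lborel ?c)"
    using emeasure_lborel_cbox_finite[of a "\<chi> i. a $ i + l"]
    by (intro emeasure_eq_ennreal_measure) (metis infinity_ennreal_def less_irrefl)
  also have "measure lborel ?c = l ^ CARD('n)"
    using assms(1) by (subst content_cbox_cart) (auto simp: interval_ne_empty_cart)
  finally show "emeasure lebesgue Q = ennreal (l ^ CARD('n))" .
  then show "measure lebesgue Q = l ^ CARD('n)" using assms(1) by (simp add: measure_def)
qed

lemma is_cube_lebesgue:
  assumes "is_cube Q"
  shows "Q \<in> sets lebesgue" "emeasure lebesgue Q = ennreal (measure lebesgue Q)"
    "0 < measure lebesgue Q"
proof -
  obtain a l where al: "0 < l" "box a (\<chi> i. a $ i + l) \<subseteq> Q" "Q \<subseteq> cbox a (\<chi> i. a $ i + l)"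
    by (rule is_cube_between_boxes[OF assms])
  note * = between_boxes_lebesgue[OF this]
  show "Q \<in> sets lebesgue" "emeasure lebesgue Q = ennreal (measure lebesgue Q)"
    "0 < measure lebesgue Q" by (simp_all only: * zero_less_power[OF al(1)])
qed

section \<open>Weights, the class \<open>A\<^sub>\<infinity>\<close> and the condition \<open>RH\<^sub>\<infinity>\<close>\<close>

lemma wmeas_eq_emeasure_density:
  "w \<in> borel_measurable lebesgue \<Longrightarrow> F \<in> sets lebesgue \<Longrightarrow>
    emeasure (density lebesgue (\<lambda>x. ennreal (w x))) F = wmeas w F"
  unfolding wmeas_def by (rule emeasure_density) auto

lemma wmeas_mono: "E \<subseteq> F \<Longrightarrow> wmeas w E \<le> wmeas w F"
  unfolding wmeas_def by (intro nn_integral_mono) (auto simp: indicator_def)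

lemma wmeas_pos:
  assumes [measurable]: "w \<in> borel_measurable lebesgue" "F \<in> sets lebesgue"
    and "\<And>x. 0 < w x" "emeasure lebesgue F \<noteq> 0"
  shows "0 < wmeas w F"
proof (rule ccontr)
  assume "\<not> 0 < wmeas w F"
  then have "wmeas w F = 0" by simp
  then have "AE x in lebesgue. ennreal (w x) * indicator F x = 0"
    unfolding wmeas_def by (subst (asm) nn_integral_0_iff_AE) auto
  then have "AE x in lebesgue. x \<notin> F"
  proof eventually_elim
    fix x assume "ennreal (w x) * indicator F x = 0"
    then show "x \<notin> F" using assms(3)[of x] by (auto simp: indicator_def ennreal_eq_0_iff)
  qed
  then show False using assms(2,4) by (simp add: AE_iff_measurable[of F])
qed

lemma wmeas_cube:
  assumes "weight w" "is_cube Q"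
  shows "0 < wmeas w Q" "wmeas w Q < top"
proof -
  show "0 < wmeas w Q"
    using assms is_cube_lebesgue[OF assms(2)] by (intro wmeas_pos) (auto simp: weight_def)
  obtain a l where al: "0 < l" "box a (\<chi> i. a $ i + l) \<subseteq> Q" "Q \<subseteq> cbox a (\<chi> i. a $ i + l)"
    by (rule is_cube_between_boxes[OF assms(2)])
  let ?c = "cbox a (\<chi> i. a $ i + l)"
  have "set_integrable lebesgue ?c w" using assms(1) by (simp add: weight_def)
  then have "(\<integral>\<^sup>+x. ennreal (norm (indicator ?c x *\<^sub>R w x)) \<partial>lebesgue) < \<infinity>"
    unfolding set_integrable_def by (simp add: integrable_iff_bounded)
  also have "(\<integral>\<^sup>+x. ennreal (norm (indicator ?c x *\<^sub>R w x)) \<partial>lebesgue) = wmeas w ?c"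
    unfolding wmeas_def using assms(1)
    by (intro nn_integral_cong) (auto simp: weight_def indicator_def less_imp_le)
  finally show "wmeas w Q < top" using le_less_trans[OF wmeas_mono[OF al(3), of w]] by simp
qed

text \<open>The form in which \<open>A\<^sub>\<infinity>\<close> is used: a set that fills a fixed fraction of a cube carries a fixed fraction of
  its \<open>u\<close>-measure.  For \<open>q = 1\<close> it suffices to integrate the condition over \<open>E\<close>.  For \<open>q > 1\<close>, Markov's inequality applied to \<open>g = u\<^bsup>-1/(q-1)\<^esup>\<close> shows that outside a set
  of measure \<open>\<eta>\<bar>Q\<bar> / 2\<close> the function \<open>g\<close> is at most \<open>2 / \<eta>\<close> times its average.  There \<open>u\<close> is bounded below by a
  multiple of \<open>(avg g)\<^bsup>-(q-1)\<^esup>\<close>, hence, by the \<open>A\<^sub>q\<close> condition, by a multiple of its own average; and half of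
  \<open>E\<close> is left.\<close>

lemma muckenhoupt_infinity_comparable:
  fixes u :: "real^'n \<Rightarrow> real"
  assumes "muckenhoupt_infinity u" "0 < \<eta>"
  obtains C :: real where "0 < C"
    "\<And>Q E. is_cube Q \<Longrightarrow> E \<in> sets lebesgue \<Longrightarrow> E \<subseteq> Q \<Longrightarrow>
      \<eta> * measure lebesgue Q \<le> measure lebesgue E \<Longrightarrow> wmeas u Q \<le> ennreal C * wmeas u E"
proof -
  obtain q where q: "1 \<le> q" "muckenhoupt q u"
    using assms(1) by (auto simp: muckenhoupt_infinity_def)
  have u: "weight u" using q(2) by (simp add: muckenhoupt_def)
  then have [measurable]: "u \<in> borel_measurable lebesgue" and upos: "\<And>x. 0 < u x"
    by (auto simp: weight_def)
  show thesis
  proof (cases "q = 1")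
    case True
    then obtain C0 where C0: "\<And>Q. is_cube Q \<Longrightarrow>
        AE x in lebesgue. x \<in> Q \<longrightarrow> wmeas u Q / emeasure lebesgue Q \<le> ennreal (C0 * u x)"
      using q by (auto simp: muckenhoupt_def)
    define A where "A = max C0 1"
    show thesis
    proof (rule that[of "A / \<eta>"])
      show "0 < A / \<eta>" using assms(2) by (simp add: A_def)
      fix Q E :: "(real^'n) set"
      assume Q: "is_cube Q" and E [measurable]: "E \<in> sets lebesgue" and EQ: "E \<subseteq> Q"
        and mE: "\<eta> * measure lebesgue Q \<le> measure lebesgue E"
      note cube = is_cube_lebesgue[OF Q]
      obtain U where U: "wmeas u Q = ennreal U" "0 < U"
        using wmeas_cube[OF u Q] by (cases "wmeas u Q") auto
      have "emeasure lebesgue E \<le> emeasure lebesgue Q" using EQ cube by (intro emeasure_mono)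
      then have EE: "emeasure lebesgue E = ennreal (measure lebesgue E)"
        using cube by (intro emeasure_eq_ennreal_measure) (auto simp: top_unique)
      have "AE x in lebesgue. ennreal (U / measure lebesgue Q) * indicator E x
          \<le> ennreal A * (ennreal (u x) * indicator E x)"
        using C0[OF Q]
      proof eventually_elim
        fix x assume *: "x \<in> Q \<longrightarrow> wmeas u Q / emeasure lebesgue Q \<le> ennreal (C0 * u x)"
        show "ennreal (U / measure lebesgue Q) * indicator E x
            \<le> ennreal A * (ennreal (u x) * indicator E x)"
        proof (cases "x \<in> E")
          case True
          then have "ennreal (U / measure lebesgue Q) \<le> ennreal (C0 * u x)"
            using * EQ U cube by (auto simp: divide_ennreal)
          also have "\<dots> \<le> ennreal (A * u x)"
            using upos[of x] by (intro ennreal_leI mult_right_mono) (auto simp: A_def)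
          finally show ?thesis using True upos[of x] by (simp add: ennreal_mult A_def)
        qed simp
      qed
      then have "(\<integral>\<^sup>+x. ennreal (U / measure lebesgue Q) * indicator E x \<partial>lebesgue)
          \<le> (\<integral>\<^sup>+x. ennreal A * (ennreal (u x) * indicator E x) \<partial>lebesgue)"
        by (rule nn_integral_mono_AE)
      then have *: "ennreal (U / measure lebesgue Q) * emeasure lebesgue E \<le> ennreal A * wmeas u E"
        by (simp add: nn_integral_cmult nn_integral_cmult_indicator wmeas_def)
      have "\<eta> * U = U / measure lebesgue Q * (\<eta> * measure lebesgue Q)" using cube(3) by simp
      also have "\<dots> \<le> U / measure lebesgue Q * measure lebesgue E"
        using mE U cube(3) by (intro mult_left_mono) auto
      finally have "ennreal (\<eta> * U) \<le> ennreal (U / measure lebesgue Q * measure lebesgue E)"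
        by (rule ennreal_leI)
      also have "\<dots> = ennreal (U / measure lebesgue Q) * emeasure lebesgue E"
        unfolding EE using U cube(3) by (intro ennreal_mult) auto
      also note *
      finally have "ennreal (1 / \<eta>) * ennreal (\<eta> * U) \<le> ennreal (1 / \<eta>) * (ennreal A * wmeas u E)"
        by (rule mult_left_mono) simp
      then show "wmeas u Q \<le> ennreal (A / \<eta>) * wmeas u E"
        using assms(2) U by (simp add: A_def mult.assoc[symmetric] flip: ennreal_mult)
    qed
  next
    case False
    then have q1: "1 < q" using q by simp
    define g where "g x = u x powr (- 1 / (q - 1))" for x
    have [measurable]: "g \<in> borel_measurable lebesgue" unfolding g_def by measurable
    have gpos: "0 < g x" for x using upos[of x] by (simp add: g_def)
    define A0 where "A0 = (SUP Q\<in>{Q. is_cube Q}. wmeas u Q / emeasure lebesgue Q *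
          enn_powr (wmeas g Q / emeasure lebesgue Q) (q - 1))"
    have "A0 < top" using q False by (simp add: muckenhoupt_def A0_def g_def[abs_def])
    then obtain A where A: "A0 = ennreal A" "0 \<le> A" by (cases A0) auto
    define C where "C = A * (2 / \<eta>) powr q + 1"
    show thesis
    proof (rule that[of C])
      show "0 < C" using A by (simp add: C_def add_nonneg_pos)
      fix Q E :: "(real^'n) set"
      assume Q: "is_cube Q" and E [measurable]: "E \<in> sets lebesgue" and EQ: "E \<subseteq> Q"
        and mE: "\<eta> * measure lebesgue Q \<le> measure lebesgue E"
      note cube = is_cube_lebesgue[OF Q]
      define V where "V = measure lebesgue Q"
      have V: "emeasure lebesgue Q = ennreal V" "0 < V" using cube by (auto simp: V_def)
      obtain U where U: "wmeas u Q = ennreal U" "0 < U"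
        using wmeas_cube[OF u Q] by (cases "wmeas u Q") auto
      have le: "ennreal (U / V) * enn_powr (wmeas g Q / ennreal V) (q - 1) \<le> ennreal A"
      proof -
        have "wmeas u Q / emeasure lebesgue Q * enn_powr (wmeas g Q / emeasure lebesgue Q) (q - 1) \<le> A0"
          unfolding A0_def using Q by (intro SUP_upper) auto
        then show ?thesis using U V A by (simp add: divide_ennreal)
      qed
      have "wmeas g Q \<noteq> top"
      proof
        assume "wmeas g Q = top"
        then have "ennreal (U / V) * top \<le> ennreal A"
          using le by (simp add: ennreal_top_divide enn_powr_def)
        then show False using U V by (simp add: ennreal_mult_top top_unique)
      qed
      moreover have "0 < wmeas g Q" using cube gpos by (intro wmeas_pos) auto
      ultimately obtain \<sigma> where \<sigma>: "wmeas g Q = ennreal \<sigma>" "0 < \<sigma>"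
        by (cases "wmeas g Q") auto
      \<comment> \<open>\<open>1 / c\<close> is \<open>2 / \<eta>\<close> times the average of \<open>g\<close>; thus Markov leaves a bad set of measure \<open>\<eta> V / 2\<close>\<close>
      define c where "c = \<eta> / (2 * (\<sigma> / V))"
      have c: "0 < c" using \<sigma> V assms(2) by (simp add: c_def)
      have "ennreal (U / V * (\<sigma> / V) powr (q - 1)) \<le> ennreal A"
      proof -
        have "ennreal (U / V * (\<sigma> / V) powr (q - 1)) = ennreal (U / V) * ennreal ((\<sigma> / V) powr (q - 1))"
          using U V by (intro ennreal_mult) auto
        then show ?thesis using le \<sigma> V by (simp add: divide_ennreal enn_powr_def)
      qed
      then have "U / V * (\<sigma> / V) powr (q - 1) \<le> A" using A by simp
      then have UA: "U \<le> A * V / (\<sigma> / V) powr (q - 1)"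
        using V \<sigma> by (simp add: field_simps)
      define L where "L = {x\<in>Q. 1 \<le> ennreal c * ennreal (g x)}"
      have "L = Q \<inter> {x\<in>space lebesgue. 1 \<le> ennreal c * ennreal (g x)}" by (auto simp: L_def)
      then have [measurable]: "L \<in> sets lebesgue" using cube(1) by simp
      have "emeasure lebesgue L \<le> ennreal c * wmeas g Q"
        unfolding L_def wmeas_def using cube(1) by (intro nn_integral_Markov_inequality) auto
      also have "\<dots> = ennreal (\<eta> * V / 2)"
        using \<sigma> V c by (simp add: c_def flip: ennreal_mult)
      finally have L: "emeasure lebesgue L \<le> ennreal (\<eta> * V / 2)" .
      have "emeasure lebesgue E \<le> emeasure lebesgue Q" using EQ cube by (intro emeasure_mono)
      then have EE: "emeasure lebesgue E = ennreal (measure lebesgue E)"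
        using V by (intro emeasure_eq_ennreal_measure) (auto simp: top_unique)
      have "ennreal (\<eta> * V) \<le> emeasure lebesgue E"
        unfolding EE using mE by (intro ennreal_leI) (simp add: V_def)
      also have "\<dots> \<le> emeasure lebesgue ((E - L) \<union> L)" by (intro emeasure_mono) auto
      also have "\<dots> \<le> emeasure lebesgue (E - L) + emeasure lebesgue L"
        by (intro emeasure_subadditive) auto
      also have "\<dots> \<le> emeasure lebesgue (E - L) + ennreal (\<eta> * V / 2)"
        using L by (intro add_left_mono)
      finally have "ennreal (\<eta> * V) \<le> emeasure lebesgue (E - L) + ennreal (\<eta> * V / 2)" .
      moreover have "ennreal (\<eta> * V) = ennreal (\<eta> * V / 2) + ennreal (\<eta> * V / 2)"
        using V assms(2) by (subst ennreal_plus[symmetric]) auto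
      ultimately have EL: "ennreal (\<eta> * V / 2) \<le> emeasure lebesgue (E - L)"
        by simp
      have "ennreal (c powr (q - 1)) * emeasure lebesgue (E - L)
          = (\<integral>\<^sup>+x. ennreal (c powr (q - 1)) * indicator (E - L) x \<partial>lebesgue)"
        by (simp add: nn_integral_cmult_indicator)
      also have "\<dots> \<le> wmeas u E"
        unfolding wmeas_def
      proof (rule nn_integral_mono)
        fix x :: "real^'n"
        show "ennreal (c powr (q - 1)) * indicator (E - L) x \<le> ennreal (u x) * indicator E x"
        proof (cases "x \<in> E - L")
          case True
          then have "\<not> 1 \<le> ennreal (c * g x)"
            using EQ c gpos[of x] by (auto simp: L_def ennreal_mult)
          then have "c * g x < 1" using c gpos[of x] by (simp flip: ennreal_1 add: not_le)
          then have "c < 1 / g x" using gpos[of x] by (simp add: field_simps)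
          also have "1 / g x = u x powr (1 / (q - 1))" by (simp add: g_def powr_minus_divide)
          finally have "c powr (q - 1) \<le> (u x powr (1 / (q - 1))) powr (q - 1)"
            using c q1 by (intro powr_mono2) auto
          also have "\<dots> = u x" using q1 upos[of x] by (simp add: powr_powr)
          finally show ?thesis using True by (auto intro: ennreal_leI)
        qed simp
      qed
      finally have "ennreal (c powr (q - 1)) * ennreal (\<eta> * V / 2) \<le> wmeas u E"
        using EL by (meson mult_left_mono order_trans zero_le)
      then have "ennreal (A * (2 / \<eta>) powr q) * (ennreal (c powr (q - 1)) * ennreal (\<eta> * V / 2))
          \<le> ennreal (A * (2 / \<eta>) powr q) * wmeas u E"
        by (rule mult_left_mono) simp
      also have "ennreal (A * (2 / \<eta>) powr q) * (ennreal (c powr (q - 1)) * ennreal (\<eta> * V / 2))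
          = ennreal (A * (2 / \<eta>) powr q * (c powr (q - 1) * (\<eta> * V / 2)))"
      proof -
        have "ennreal r * (ennreal s * ennreal t) = ennreal (r * (s * t))"
          if "0 \<le> r" "0 \<le> s" "0 \<le> t" for r s t using that by (simp add: ennreal_mult)
        then show ?thesis using A V assms(2) by simp
      qed
      also have "A * (2 / \<eta>) powr q * (c powr (q - 1) * (\<eta> * V / 2)) = A * V / (\<sigma> / V) powr (q - 1)"
      proof -
        have "c = (\<eta> / 2) / (\<sigma> / V)" by (simp add: c_def)
        then have "c powr (q - 1) = (\<eta> / 2) powr (q - 1) / (\<sigma> / V) powr (q - 1)"
          using assms(2) \<sigma> V by (simp only: powr_divide)
        moreover have "(2 / \<eta>) powr q = 1 / (\<eta> / 2) powr q"
          using assms(2) by (simp add: powr_divide)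
        moreover have "(\<eta> / 2) powr q = (\<eta> / 2) powr (q - 1) * (\<eta> / 2)"
          using assms(2) powr_add[of "\<eta> / 2" "q - 1" 1] by simp
        ultimately show ?thesis using assms(2) by simp
      qed
      finally have "ennreal U \<le> ennreal (A * (2 / \<eta>) powr q) * wmeas u E"
        using UA ennreal_leI order_trans by blast
      also have "\<dots> \<le> ennreal C * wmeas u E"
        using A by (intro mult_right_mono ennreal_leI) (auto simp: C_def)
      finally show "wmeas u Q \<le> ennreal C * wmeas u E" using U by simp
    qed
  qed
qed

text \<open>Almost everywhere on \<open>Q\<close> the condition \<open>RH\<^sub>\<infinity>(w)\<close> reads \<open>g \<le> K (wg)(Q) / w(Q)\<close>; integrate this over \<open>F\<close> with
  respect to \<open>w\<close>.  Put differently, \<open>w = (wg) g\<^bsup>-1\<^esup>\<close> where \<open>g\<^bsup>-1\<^esup>\<close> satisfies an \<open>A\<^sub>1\<close> condition with respect to \<open>wg\<close>, so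
  lower bounds for the fraction of \<open>Q\<close> occupied by \<open>F\<close> pass from \<open>wg\<close> to \<open>w\<close>.\<close>

lemma RH_infinity_comparable:
  fixes w g :: "real^'n \<Rightarrow> real"
  assumes w: "weight w" and wg: "weight (\<lambda>x. w x * g x)" and g: "\<And>x. 0 < g x"
    and fin: "RH_infinity_const w g < top"
  obtains K :: real where "0 < K"
    "\<And>Q F. is_cube Q \<Longrightarrow> F \<in> sets lebesgue \<Longrightarrow> F \<subseteq> Q \<Longrightarrow>
      wmeas w Q * wmeas (\<lambda>x. w x * g x) F
        \<le> ennreal K * wmeas (\<lambda>x. w x * g x) Q * wmeas w F"
proof -
  have [measurable]: "w \<in> borel_measurable lebesgue" and wpos: "\<And>x. 0 < w x"
    using w by (auto simp: weight_def)
  obtain K0 where K0: "RH_infinity_const w g = ennreal K0" "0 \<le> K0"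
    using fin by (cases "RH_infinity_const w g") auto
  show thesis
  proof (rule that[of "K0 + 1"])
    fix Q F :: "(real^'n) set"
    assume Q: "is_cube Q" and F [measurable]: "F \<in> sets lebesgue" and FQ: "F \<subseteq> Q"
    let ?W = "wmeas w Q" and ?N = "wmeas (\<lambda>x. w x * g x) Q"
    define e where "e = esssup (density lebesgue (\<lambda>x. ennreal (w x))) (\<lambda>x. ennreal (indicator Q x * \<bar>g x\<bar>))"
    have "?W / ?N * e \<le> ennreal K0"
      unfolding K0(1)[symmetric] RH_infinity_const_def e_def using Q by (intro SUP_upper) auto
    then have "?W / ?N * e * ?N \<le> ennreal K0 * ?N" by (intro mult_right_mono) auto
    moreover have "?W / ?N * e * ?N = ?W * e"
    proof -
      obtain U where U: "?W = ennreal U" "0 < U"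
        using wmeas_cube[OF w Q] by (cases ?W) auto
      obtain n where n: "?N = ennreal n" "0 < n"
        using wmeas_cube[OF wg Q] by (cases ?N) auto
      have "?W / ?N * ?N = ?W" using U n by (simp add: divide_ennreal flip: ennreal_mult)
      then show ?thesis by (metis mult.assoc mult.commute)
    qed
    ultimately have We: "?W * e \<le> ennreal K0 * ?N" by simp
    have "AE x in density lebesgue (\<lambda>x. ennreal (w x)). ennreal (indicator Q x * \<bar>g x\<bar>) \<le> e"
      unfolding e_def by (rule esssup_AE)
    then have "AE x in lebesgue. 0 < ennreal (w x) \<longrightarrow> ennreal (indicator Q x * \<bar>g x\<bar>) \<le> e"
      by (subst (asm) AE_density) auto
    then have "AE x in lebesgue. ennreal (w x * g x) * indicator F x \<le> e * (ennreal (w x) * indicator F x)"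
    proof eventually_elim
      fix x assume *: "0 < ennreal (w x) \<longrightarrow> ennreal (indicator Q x * \<bar>g x\<bar>) \<le> e"
      show "ennreal (w x * g x) * indicator F x \<le> e * (ennreal (w x) * indicator F x)"
      proof (cases "x \<in> F")
        case True
        then have "ennreal (g x) \<le> e" using * FQ wpos[of x] g[of x] by auto
        then have "ennreal (w x) * ennreal (g x) \<le> ennreal (w x) * e" by (rule mult_left_mono) simp
        then show ?thesis using True wpos[of x] g[of x] by (simp add: ennreal_mult mult.commute)
      qed simp
    qed
    then have "wmeas (\<lambda>x. w x * g x) F \<le> e * wmeas w F"
      unfolding wmeas_def by (subst nn_integral_cmult[symmetric]) (auto intro: nn_integral_mono_AE)
    then have "?W * wmeas (\<lambda>x. w x * g x) F \<le> ?W * (e * wmeas w F)" by (rule mult_left_mono) simp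
    also have "\<dots> = ?W * e * wmeas w F" by (simp add: mult.assoc)
    also have "\<dots> \<le> ennreal K0 * ?N * wmeas w F" by (rule mult_right_mono[OF We]) simp
    also have "\<dots> \<le> ennreal (K0 + 1) * ?N * wmeas w F"
      by (intro mult_right_mono ennreal_leI) auto
    finally show "?W * wmeas (\<lambda>x. w x * g x) F \<le> ennreal (K0 + 1) * ?N * wmeas w F" .
  qed (use K0 in simp)
qed

section \<open>A covering lemma for doubling weights\<close>

text \<open>Greedy selection: take a member of maximal size, discard whatever meets it, and repeat.\<close>

lemma finite_vitali_selection:
  fixes l :: "'a set \<Rightarrow> real"
  assumes "finite T" "{} \<notin> T"
  obtains T' where "T' \<subseteq> T" "disjoint T'" "\<And>R. R \<in> T \<Longrightarrow> \<exists>Q\<in>T'. Q \<inter> R \<noteq> {} \<and> l R \<le> l Q"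
proof -
  have "\<exists>T'\<subseteq>T. disjoint T' \<and> (\<forall>R\<in>T. \<exists>Q\<in>T'. Q \<inter> R \<noteq> {} \<and> l R \<le> l Q)"
    using assms
  proof (induction T rule: finite_psubset_induct)
    case (psubset T)
    show ?case
    proof (cases "T = {}")
      case True
      then show ?thesis by (auto simp: disjoint_def)
    next
      case False
      then have "Max (l ` T) \<in> l ` T" using psubset.hyps by (intro Max_in) auto
      then obtain P where "P \<in> T" "l P = Max (l ` T)" by (metis imageE)
      then have P: "P \<in> T" "\<And>R. R \<in> T \<Longrightarrow> l R \<le> l P"
        using psubset.hyps by auto
      define T1 where "T1 = {R\<in>T. P \<inter> R = {}}"
      have "P \<noteq> {}" using P(1) psubset.prems by auto
      then have "T1 \<subset> T" using P(1) by (auto simp: T1_def)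
      then obtain T' where T': "T' \<subseteq> T1" "disjoint T'"
          "\<And>R. R \<in> T1 \<Longrightarrow> \<exists>Q\<in>T'. Q \<inter> R \<noteq> {} \<and> l R \<le> l Q"
        using psubset.IH[of T1] psubset.prems by (auto simp: T1_def)
      show ?thesis
      proof (intro exI[of _ "insert P T'"] conjI ballI)
        show "insert P T' \<subseteq> T" using T' P by (auto simp: T1_def)
        show "disjoint (insert P T')"
          using T' by (auto simp: disjoint_def T1_def)
        fix R assume "R \<in> T"
        then show "\<exists>Q\<in>insert P T'. Q \<inter> R \<noteq> {} \<and> l R \<le> l Q"
          using P T' by (cases "R \<in> T1") (auto simp: T1_def)
      qed
    qed
  qed
  then show ?thesis using that by auto
qed

text \<open>The geometry behind the covering argument, with the side length and the concentric cube of three times the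
  side turned into functions of the cube.\<close>

lemma cube_tripling:
  obtains triple :: "(real^'n) set \<Rightarrow> (real^'n) set" and side :: "(real^'n) set \<Rightarrow> real"
  where
    "\<And>Q. is_cube Q \<Longrightarrow> is_cube (triple Q) \<and> Q \<subseteq> triple Q \<and>
      measure lebesgue (triple Q) = 3 ^ CARD('n) * measure lebesgue Q"
    "\<And>Q R. is_cube Q \<Longrightarrow> is_cube R \<Longrightarrow> Q \<inter> R \<noteq> {} \<Longrightarrow> side R \<le> side Q \<Longrightarrow> R \<subseteq> triple Q"
proof -
  have "\<forall>Q::(real^'n) set. \<exists>a l. is_cube Q \<longrightarrow>
      0 < l \<and> box a (\<chi> i. a $ i + l) \<subseteq> Q \<and> Q \<subseteq> cbox a (\<chi> i. a $ i + l)"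
    by (auto elim!: is_cube_between_boxes)
  then obtain a l where al: "\<And>Q::(real^'n) set. is_cube Q \<Longrightarrow>
      0 < l Q \<and> box (a Q) (\<chi> i. a Q $ i + l Q) \<subseteq> Q \<and> Q \<subseteq> cbox (a Q) (\<chi> i. a Q $ i + l Q)"
    by metis
  define corner where "corner Q = (\<chi> i. a Q $ i - l Q)" for Q
  define triple where "triple Q = cbox (corner Q) (\<chi> i. corner Q $ i + 3 * l Q)" for Q
  have mem: "x \<in> triple Q \<longleftrightarrow> (\<forall>i. a Q $ i - l Q \<le> x $ i \<and> x $ i \<le> a Q $ i + 2 * l Q)" for x Q
    by (simp add: triple_def corner_def mem_box_cart add.commute)
  have memQ: "a Q $ i \<le> x $ i \<and> x $ i \<le> a Q $ i + l Q" if "is_cube Q" "x \<in> Q" for Q x i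
    using al[OF that(1)] that(2) by (auto simp: mem_box_cart dest!: subsetD)
  show thesis
  proof (rule that[of triple l])
    fix Q :: "(real^'n) set" assume Q: "is_cube Q"
    have "measure lebesgue Q = l Q ^ CARD('n)"
      using al[OF Q] between_boxes_lebesgue(3) by blast
    moreover have "measure lebesgue (triple Q) = (3 * l Q) ^ CARD('n)"
      unfolding triple_def using al[OF Q] by (intro between_boxes_lebesgue(3)) (auto intro: box_subset_cbox[THEN subsetD])
    moreover have "Q \<subseteq> triple Q"
    proof
      fix x assume "x \<in> Q"
      then show "x \<in> triple Q" using memQ[OF Q] al[OF Q] by (smt (verit) mem)
    qed
    moreover have "is_cube (triple Q)"
      unfolding triple_def using al[OF Q] by (intro is_cube_cbox) auto
    ultimately show "is_cube (triple Q) \<and> Q \<subseteq> triple Q \<and>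
        measure lebesgue (triple Q) = 3 ^ CARD('n) * measure lebesgue Q"
      by (simp add: power_mult_distrib)
  next
    fix Q R :: "(real^'n) set"
    assume Q: "is_cube Q" and R: "is_cube R" and meet: "Q \<inter> R \<noteq> {}" and le: "l R \<le> l Q"
    obtain z where z: "z \<in> Q" "z \<in> R" using meet by auto
    show "R \<subseteq> triple Q"
    proof
      fix x assume "x \<in> R"
      then show "x \<in> triple Q"
        unfolding mem using memQ[OF Q z(1)] memQ[OF R z(2)] memQ[OF R, of x] le by (smt (verit))
    qed
  qed
qed

text \<open>The weak type \<open>(1,1)\<close> inequality for the maximal operator of the measure \<open>w dx\<close>, applied to the indicator
  of \<open>Y\<close>, for a finite family: the triples of a disjoint subfamily cover the union, by doubling they
  weigh at most \<open>D\<close> times as much as the selected cubes, and the latter share the weight of \<open>Y\<close>.\<close>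

lemma doubling_covering:
  fixes w :: "real^'n \<Rightarrow> real"
  assumes w: "w \<in> borel_measurable lebesgue"
    and doubling: "\<And>Q R. is_cube Q \<Longrightarrow> is_cube R \<Longrightarrow> Q \<subseteq> R \<Longrightarrow>
      measure lebesgue R = 3 ^ CARD('n) * measure lebesgue Q \<Longrightarrow> wmeas w R \<le> ennreal D * wmeas w Q"
    and T: "finite T" "\<And>Q. Q \<in> T \<Longrightarrow> is_cube Q" and Y: "Y \<in> sets lebesgue"
    and dense: "\<And>Q. Q \<in> T \<Longrightarrow> ennreal t * wmeas w Q \<le> wmeas w (Q \<inter> Y)"
  shows "ennreal t * wmeas w (\<Union>T) \<le> ennreal D * wmeas w Y"
proof -
  let ?M = "density lebesgue (\<lambda>x. ennreal (w x))"
  note em = wmeas_eq_emeasure_density[OF w, symmetric]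
  obtain triple :: "(real^'n) set \<Rightarrow> (real^'n) set" and side where triple: "\<And>Q. is_cube Q \<Longrightarrow> is_cube (triple Q) \<and> Q \<subseteq> triple Q \<and>
      measure lebesgue (triple Q) = 3 ^ CARD('n) * measure lebesgue Q"
    and engulf: "\<And>Q R. is_cube Q \<Longrightarrow> is_cube R \<Longrightarrow> Q \<inter> R \<noteq> {} \<Longrightarrow>
      side R \<le> (side Q :: real) \<Longrightarrow> R \<subseteq> triple Q"
    by (rule cube_tripling[where 'n = 'n]) (rule that)
  have nonempty: "{} \<notin> T" using is_cube_lebesgue(3)[OF T(2)] by fastforce
  obtain T' where T': "T' \<subseteq> T" "disjoint T'"
      "\<And>R. R \<in> T \<Longrightarrow> \<exists>Q\<in>T'. Q \<inter> R \<noteq> {} \<and> side R \<le> side Q"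
    by (rule finite_vitali_selection[OF T(1) nonempty, of side]) (rule that)
  have fin: "finite T'" using T(1) T'(1) finite_subset by auto
  have meas: "Q \<in> sets lebesgue" "triple Q \<in> sets lebesgue" if "Q \<in> T'" for Q
  proof -
    have "is_cube Q" using that T' T(2) by auto
    then show "Q \<in> sets lebesgue" "triple Q \<in> sets lebesgue"
      using triple is_cube_lebesgue(1) by auto
  qed
  have "\<Union>T \<subseteq> (\<Union>Q\<in>T'. triple Q)"
  proof
    fix x assume "x \<in> \<Union>T"
    then obtain R where R: "R \<in> T" "x \<in> R" by auto
    then obtain Q where Q: "Q \<in> T'" "Q \<inter> R \<noteq> {}" "side R \<le> side Q" using T'(3) by blast
    then have "R \<subseteq> triple Q" using R(1) T'(1) T(2) by (intro engulf) auto
    then show "x \<in> (\<Union>Q\<in>T'. triple Q)" using R(2) Q(1) by auto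
  qed
  then have "wmeas w (\<Union>T) \<le> emeasure ?M (\<Union>Q\<in>T'. triple Q)"
    using meas fin by (subst em[symmetric]) (auto intro!: wmeas_mono sets.finite_UN)
  also have "\<dots> \<le> (\<Sum>Q\<in>T'. emeasure ?M (triple Q))"
    using meas fin by (intro emeasure_subadditive_finite) auto
  also have "\<dots> \<le> (\<Sum>Q\<in>T'. ennreal D * wmeas w Q)"
    using meas T' T(2) triple by (intro sum_mono) (auto simp: em[symmetric] subset_eq intro!: doubling)
  finally have "ennreal t * wmeas w (\<Union>T) \<le> ennreal t * (\<Sum>Q\<in>T'. ennreal D * wmeas w Q)"
    by (rule mult_left_mono) simp
  also have "\<dots> = (\<Sum>Q\<in>T'. ennreal D * (ennreal t * wmeas w Q))"
    by (simp add: sum_distrib_left mult.left_commute)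
  also have "\<dots> \<le> (\<Sum>Q\<in>T'. ennreal D * wmeas w (Q \<inter> Y))"
    using dense T'(1) by (intro sum_mono mult_left_mono) auto
  also have "\<dots> = ennreal D * (\<Sum>Q\<in>T'. emeasure ?M (Q \<inter> Y))"
    using meas Y by (simp add: sum_distrib_left em)
  also have "(\<Sum>Q\<in>T'. emeasure ?M (Q \<inter> Y)) = emeasure ?M (\<Union>Q\<in>T'. Q \<inter> Y)"
  proof (rule sum_emeasure)
    show "disjoint_family_on (\<lambda>Q. Q \<inter> Y) T'"
      using T'(2) unfolding disjoint_def disjoint_family_on_def by blast
  qed (use meas Y fin in auto)
  also have "\<dots> \<le> emeasure ?M Y" using Y by (intro emeasure_mono) auto
  also have "\<dots> = wmeas w Y" using Y by (simp add: em)
  finally show ?thesis by (simp add: mult_left_mono)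
qed

section \<open>Sparse operators, maximal operators and weak norms\<close>

text \<open>The product of averages that enters the maximal operator, with infinite averages absorbed by the type.\<close>

definition avg_prod :: "nat \<Rightarrow> (nat \<Rightarrow> real^'n \<Rightarrow> real) \<Rightarrow> (real^'n) set \<Rightarrow> ennreal" where
  "avg_prod m f Q =
    (\<Prod>i<m. (\<integral>\<^sup>+x\<in>Q. ennreal \<bar>f i x\<bar> \<partial>lebesgue) / ennreal (measure lebesgue Q))"

lemma enn2ereal_divide_pos:
  "0 < r \<Longrightarrow> enn2ereal I / ereal r = enn2ereal (I / ennreal r)"
  by (cases I) (auto simp: divide_ennreal ennreal_top_divide)

lemma cube_avg_abs:
  assumes "is_cube Q"
  shows "cube_avg (\<lambda>z. \<bar>f z\<bar>) Q
    = enn2ereal ((\<integral>\<^sup>+x\<in>Q. ennreal \<bar>f x\<bar> \<partial>lebesgue) / ennreal (measure lebesgue Q))"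
  using is_cube_lebesgue(3)[OF assms]
  by (simp add: cube_avg_def ennreal_neg enn2ereal_divide_pos zero_ennreal.rep_eq)

text \<open>This also covers \<open>\<infinity> - \<infinity>\<close>, as both sides are then \<open>\<infinity>\<close>.  By it, signed averages and signed
  sums are dominated by those of the absolute values.\<close>

lemma abs_enn2ereal_diff_le: "\<bar>enn2ereal a - enn2ereal b\<bar> \<le> enn2ereal (a + b)"
  by (cases a; cases b) (auto simp: plus_ennreal.rep_eq)

lemma abs_cube_avg_le:
  assumes Q: "is_cube Q" and [measurable]: "f \<in> borel_measurable lebesgue"
  shows "\<bar>cube_avg f Q\<bar>
    \<le> enn2ereal ((\<integral>\<^sup>+x\<in>Q. ennreal \<bar>f x\<bar> \<partial>lebesgue) / ennreal (measure lebesgue Q))"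
proof -
  note [measurable] = is_cube_lebesgue(1)[OF Q]
  let ?P = "\<integral>\<^sup>+x\<in>Q. ennreal (f x) \<partial>lebesgue" and ?N = "\<integral>\<^sup>+x\<in>Q. ennreal (- f x) \<partial>lebesgue"
  have V: "0 < measure lebesgue Q" by (rule is_cube_lebesgue(3)[OF Q])
  have "?P + ?N = (\<integral>\<^sup>+x. ennreal (f x) * indicator Q x + ennreal (- f x) * indicator Q x \<partial>lebesgue)"
    by (rule nn_integral_add[symmetric]) auto
  also have "\<dots> = (\<integral>\<^sup>+x\<in>Q. ennreal \<bar>f x\<bar> \<partial>lebesgue)"
    by (intro nn_integral_cong) (auto simp: indicator_def abs_if ennreal_neg)
  finally have PN: "?P + ?N = (\<integral>\<^sup>+x\<in>Q. ennreal \<bar>f x\<bar> \<partial>lebesgue)" .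
  have "\<bar>cube_avg f Q\<bar> = \<bar>enn2ereal ?P - enn2ereal ?N\<bar> / ereal (measure lebesgue Q)"
    using V by (simp add: cube_avg_def divide_ereal_def ereal_abs_mult)
  also have "\<dots> \<le> enn2ereal (?P + ?N) / ereal (measure lebesgue Q)"
    using V by (intro ereal_divide_right_mono abs_enn2ereal_diff_le) auto
  also have "\<dots> = enn2ereal ((?P + ?N) / ennreal (measure lebesgue Q))"
    by (rule enn2ereal_divide_pos[OF V])
  finally show ?thesis unfolding PN .
qed

lemma enn2ereal_prod: "enn2ereal (\<Prod>i\<in>A. g i) = (\<Prod>i\<in>A. enn2ereal (g i))"
  by (induction A rule: infinite_finite_induct) (auto simp: times_ennreal.rep_eq one_ennreal.rep_eq)

lemma abs_prod_ereal_le: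
  fixes g :: "'b \<Rightarrow> ereal"
  assumes "\<And>i. i \<in> A \<Longrightarrow> \<bar>g i\<bar> \<le> h i"
  shows "\<bar>\<Prod>i\<in>A. g i\<bar> \<le> (\<Prod>i\<in>A. h i)"
  using assms
proof (induction A rule: infinite_finite_induct)
  case (insert i A)
  then have "0 \<le> h i" by (meson abs_ereal_pos insertI1 order_trans)
  with insert show ?case
    by (simp add: ereal_abs_mult) (intro ereal_mult_mono; simp)
qed simp_all

lemma maximal_operator_ge:
  assumes "is_cube Q" "x \<in> Q"
  shows "enn2ereal (avg_prod m f Q) \<le> maximal_operator m f x"
proof -
  have "enn2ereal (avg_prod m f Q) = (\<Prod>i<m. cube_avg (\<lambda>z. \<bar>f i z\<bar>) Q) * indicator Q x"
    using assms by (simp add: avg_prod_def enn2ereal_prod cube_avg_abs)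
  also have "\<dots> \<le> maximal_operator m f x"
    unfolding maximal_operator_def using assms(1) by (intro SUP_upper) auto
  finally show ?thesis .
qed

lemma abs_ereal_sum_le: "\<bar>ereal_sum t S\<bar> \<le> enn2ereal (\<Sum>\<^sub>\<infinity>Q\<in>S. e2ennreal \<bar>t Q\<bar>)"
proof -
  have "\<bar>ereal_sum t S\<bar> \<le> enn2ereal ((\<Sum>\<^sub>\<infinity>Q\<in>S. e2ennreal (t Q)) + (\<Sum>\<^sub>\<infinity>Q\<in>S. e2ennreal (- t Q)))"
    unfolding ereal_sum_def by (rule abs_enn2ereal_diff_le)
  also have "(\<Sum>\<^sub>\<infinity>Q\<in>S. e2ennreal (t Q)) + (\<Sum>\<^sub>\<infinity>Q\<in>S. e2ennreal (- t Q))
      = (\<Sum>\<^sub>\<infinity>Q\<in>S. e2ennreal (t Q) + e2ennreal (- t Q))"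
    by (intro infsum_add[symmetric] nonneg_summable_on_complete) auto
  also have "\<dots> = (\<Sum>\<^sub>\<infinity>Q\<in>S. e2ennreal \<bar>t Q\<bar>)"
  proof (rule infsum_cong)
    fix Q
    show "e2ennreal (t Q) + e2ennreal (- t Q) = e2ennreal \<bar>t Q\<bar>"
      by (cases "0 \<le> t Q") (auto simp: e2ennreal_neg abs_ereal_less0 not_le)
  qed
  finally show ?thesis .
qed

lemma abs_sparse_operator_le:
  assumes S: "\<And>Q. Q \<in> S \<Longrightarrow> is_cube Q" and f: "\<And>i. i < m \<Longrightarrow> f i \<in> borel_measurable lebesgue"
  shows "\<bar>sparse_operator m S f x\<bar> \<le> enn2ereal (\<Sum>\<^sub>\<infinity>Q\<in>S. avg_prod m f Q * indicator Q x)"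
proof -
  have "\<bar>sparse_operator m S f x\<bar> \<le> enn2ereal (\<Sum>\<^sub>\<infinity>Q\<in>S. e2ennreal \<bar>sparse_term m f x Q\<bar>)"
    unfolding sparse_operator_def by (rule abs_ereal_sum_le)
  also have "(\<Sum>\<^sub>\<infinity>Q\<in>S. e2ennreal \<bar>sparse_term m f x Q\<bar>)
      \<le> (\<Sum>\<^sub>\<infinity>Q\<in>S. avg_prod m f Q * indicator Q x)"
  proof (intro infsum_mono nonneg_summable_on_complete)
    fix Q assume Q: "Q \<in> S"
    have "\<bar>\<Prod>i<m. cube_avg (f i) Q\<bar> \<le> enn2ereal (avg_prod m f Q)"
      unfolding avg_prod_def enn2ereal_prod
      by (intro abs_prod_ereal_le abs_cube_avg_le S Q f) auto
    then have "e2ennreal \<bar>\<Prod>i<m. cube_avg (f i) Q\<bar> \<le> avg_prod m f Q"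
      using e2ennreal_mono by fastforce
    then show "e2ennreal \<bar>sparse_term m f x Q\<bar> \<le> avg_prod m f Q * indicator Q x"
      by (cases "x \<in> Q") (auto simp: sparse_term_def e2ennreal_neg)
  qed auto
  finally show ?thesis by (simp add: less_eq_ennreal.rep_eq)
qed

text \<open>Subsets \<open>X\<close> are allowed because the level sets of a supremum over uncountably many cubes are not obviously
  measurable, while the level sets for finitely many cubes are.\<close>

lemma weak_Lp_norm_tail:
  assumes "weak_Lp_norm p w g \<le> ennreal A" "0 \<le> A" "0 < p" "0 < s"
    and sub: "X \<subseteq> {x. ereal s < \<bar>g x\<bar>}"
  shows "wmeas w X \<le> ennreal (A powr p * s powr - p)"
proof -
  define \<mu> where "\<mu> = wmeas w {x. ereal s < \<bar>g x\<bar>}"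
  have le: "ennreal s * enn_powr \<mu> (1 / p) \<le> ennreal A"
  proof -
    have "ennreal s * enn_powr \<mu> (1 / p) \<le> weak_Lp_norm p w g"
      unfolding weak_Lp_norm_def \<mu>_def using assms(4) by (intro SUP_upper) auto
    then show ?thesis using assms(1) by (rule order_trans)
  qed
  have "\<mu> \<noteq> top"
    using le assms(4) by (auto simp: enn_powr_def ennreal_mult_top top_unique)
  then obtain u where u: "\<mu> = ennreal u" "0 \<le> u" by (cases \<mu>) auto
  have "s * u powr (1 / p) \<le> A"
    using le u assms(2,4) by (simp add: enn_powr_def flip: ennreal_mult)
  then have "u powr (1 / p) \<le> A / s" using assms(4) by (simp add: field_simps)
  then have "(u powr (1 / p)) powr p \<le> (A / s) powr p"
    using assms(3) by (intro powr_mono2) auto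
  then have "u \<le> A powr p * s powr - p"
    using u assms(2-4) by (simp add: powr_powr powr_divide powr_minus_divide)
  then show ?thesis using wmeas_mono[OF sub, of w] u
    by (auto simp: \<mu>_def intro: order_trans ennreal_leI)
qed

lemma weak_Lp_norm_leI:
  assumes "0 < p" "0 \<le> c"
    and *: "\<And>y. 0 < y \<Longrightarrow> wmeas w {x. ereal y < \<bar>g x\<bar>} \<le> ennreal (c * y powr - p)"
  shows "weak_Lp_norm p w g \<le> ennreal (c powr (1 / p))"
  unfolding weak_Lp_norm_def
proof (rule SUP_least)
  fix y :: real assume "y \<in> {0<..}"
  then have y: "0 < y" by simp
  obtain u where u: "wmeas w {x. ereal y < \<bar>g x\<bar>} = ennreal u" "0 \<le> u"
    using *[OF y] by (cases "wmeas w {x. ereal y < \<bar>g x\<bar>}") (auto simp: top_unique)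
  have "u \<le> c * y powr - p" using *[OF y] u assms(2) by simp
  then have "u powr (1 / p) \<le> (c * y powr - p) powr (1 / p)"
    using u assms(1) by (intro powr_mono2) auto
  also have "\<dots> = c powr (1 / p) / y"
    using y assms(1,2) by (simp add: powr_mult powr_divide powr_powr powr_minus_divide)
  finally have "y * u powr (1 / p) \<le> c powr (1 / p)" using y by (simp add: field_simps)
  then show "ennreal y * enn_powr (wmeas w {x. ereal y < \<bar>g x\<bar>}) (1 / p) \<le> ennreal (c powr (1 / p))"
    using u y by (simp add: enn_powr_def ennreal_leI flip: ennreal_mult)
qed

text \<open>Inside each ball the measures of the disjoint sets have finite sums, so only countably many of them are
  nonzero.\<close>

lemma countable_disjoint_positive_measure:
  fixes E :: "'b \<Rightarrow> 'a::euclidean_space set"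
  assumes disj: "disjoint_family_on E S"
    and E: "\<And>Q. Q \<in> S \<Longrightarrow> E Q \<in> sets lebesgue" "\<And>Q. Q \<in> S \<Longrightarrow> 0 < emeasure lebesgue (E Q)"
  shows "countable S"
proof -
  define B where "B n = cball (0::'a) (real n)" for n
  have Bm: "B n \<in> lmeasurable" for n by (simp add: B_def)
  have EB: "E Q \<inter> B n \<in> lmeasurable" if "Q \<in> S" for Q n
    using E(1)[OF that] Bm[of n] by (metis fmeasurable_Int_fmeasurable inf_commute)
  have cnt: "countable {Q\<in>S. measure lebesgue (E Q \<inter> B n) \<noteq> 0}" for n
  proof (rule summable_countable_real, rule nonneg_bdd_above_summable_on)
    show "bdd_above (sum (\<lambda>Q. measure lebesgue (E Q \<inter> B n)) ` {F. F \<subseteq> S \<and> finite F})"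
    proof (rule bdd_aboveI2)
      fix F assume F: "F \<in> {F. F \<subseteq> S \<and> finite F}"
      have "(\<Sum>Q\<in>F. measure lebesgue (E Q \<inter> B n)) = measure lebesgue (\<Union>Q\<in>F. E Q \<inter> B n)"
      proof (rule measure_finite_Union[symmetric])
        show "disjoint_family_on (\<lambda>Q. E Q \<inter> B n) F"
          using disj F unfolding disjoint_family_on_def by blast
      qed (use F EB in \<open>auto simp: fmeasurable_def less_top[symmetric]\<close>)
      also have "\<dots> \<le> measure lebesgue (B n)"
        using F E(1) Bm by (intro measure_mono_fmeasurable) (auto intro!: sets.finite_UN simp: fmeasurableD)
      finally show "(\<Sum>Q\<in>F. measure lebesgue (E Q \<inter> B n)) \<le> measure lebesgue (B n)" .
    qed
  qed auto
  have "S \<subseteq> (\<Union>n. {Q\<in>S. measure lebesgue (E Q \<inter> B n) \<noteq> 0})"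
  proof
    fix Q assume Q: "Q \<in> S"
    have "\<exists>n. measure lebesgue (E Q \<inter> B n) \<noteq> 0"
    proof (rule ccontr)
      assume "\<not> ?thesis"
      then have "emeasure lebesgue (E Q \<inter> B n) = 0" for n
        using EB[OF Q, of n] by (simp add: emeasure_eq_measure2)
      then have "emeasure lebesgue (\<Union>n. E Q \<inter> B n) = 0"
        using EB[OF Q] by (intro emeasure_UN_eq_0) (auto simp: fmeasurableD)
      moreover have "(\<Union>n. E Q \<inter> B n) = E Q"
        by (auto simp: B_def intro: real_arch_simple)
      ultimately show False using E(2)[OF Q] by simp
    qed
    then show "Q \<in> (\<Union>n. {Q\<in>S. measure lebesgue (E Q \<inter> B n) \<noteq> 0})" using Q by auto
  qed
  then show ?thesis by (rule countable_subset) (auto intro: cnt)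
qed

text \<open>The level sets of the full sum are the increasing union of those of the partial sums along an enumeration
  of \<open>S\<close>; countability makes them measurable and gives continuity from below.\<close>

lemma finite_families_suffice:
  fixes b :: "'a set \<Rightarrow> ennreal"
  assumes S: "countable S" "\<And>Q. Q \<in> S \<Longrightarrow> Q \<in> sets M"
    and [measurable]: "u \<in> borel_measurable M"
    and fin: "\<And>F. finite F \<Longrightarrow> F \<subseteq> S \<Longrightarrow>
      emeasure M {x\<in>space M. u x < (\<Sum>Q\<in>F. b Q * indicator Q x)} \<le> c"
  shows "{x\<in>space M. u x < (\<Sum>\<^sub>\<infinity>Q\<in>S. b Q * indicator Q x)} \<in> sets M"
    "emeasure M {x\<in>space M. u x < (\<Sum>\<^sub>\<infinity>Q\<in>S. b Q * indicator Q x)} \<le> c"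
proof -
  define S' where "S' n = {Q\<in>S. to_nat_on S Q < n}" for n
  have S': "S' n \<subseteq> S" "finite (S' n)" for n
  proof -
    have "S' n = to_nat_on S -` {..<n} \<inter> S" by (auto simp: S'_def)
    then show "finite (S' n)" using inj_on_to_nat_on[OF S(1)] by (simp add: finite_vimage_IntI)
  qed (auto simp: S'_def)
  define Z where "Z n = {x\<in>space M. u x < (\<Sum>Q\<in>S' n. b Q * indicator Q x)}" for n
  have [measurable]: "Q \<in> sets M" if "Q \<in> S' n" for Q n using that S' S(2) by blast
  have Zm: "Z n \<in> sets M" for n unfolding Z_def by measurable
  have mono: "(\<Sum>Q\<in>F. b Q * indicator Q x) \<le> (\<Sum>Q\<in>G. b Q * indicator Q x)"
    if "F \<subseteq> G" "finite G" for F G x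
    using that by (intro sum_mono2) auto
  have "incseq Z"
  proof (rule incseq_SucI, unfold Z_def, clarify)
    fix n x assume "u x < (\<Sum>Q\<in>S' n. b Q * indicator Q x)"
    also have "\<dots> \<le> (\<Sum>Q\<in>S' (Suc n). b Q * indicator Q x)"
      using S' by (intro mono) (auto simp: S'_def)
    finally show "u x < (\<Sum>Q\<in>S' (Suc n). b Q * indicator Q x)" .
  qed
  have sup: "(\<Sum>\<^sub>\<infinity>Q\<in>S. b Q * indicator Q x)
      = (SUP F\<in>{F. finite F \<and> F \<subseteq> S}. \<Sum>Q\<in>F. b Q * indicator Q x)" for x
    by (rule nonneg_infsum_complete) simp
  have eq: "{x\<in>space M. u x < (\<Sum>\<^sub>\<infinity>Q\<in>S. b Q * indicator Q x)} = (\<Union>n. Z n)"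
  proof (intro equalityI subsetI)
    fix x assume "x \<in> {x\<in>space M. u x < (\<Sum>\<^sub>\<infinity>Q\<in>S. b Q * indicator Q x)}"
    then obtain F where x: "x \<in> space M" and F: "finite F" "F \<subseteq> S"
        and less: "u x < (\<Sum>Q\<in>F. b Q * indicator Q x)"
      unfolding sup less_SUP_iff by blast
    obtain n where n: "\<forall>k\<in>to_nat_on S ` F. k < n"
      using F(1) finite_nat_set_iff_bounded by blast
    have "F \<subseteq> S' n" using n F(2) by (auto simp: S'_def)
    then have "u x < (\<Sum>Q\<in>S' n. b Q * indicator Q x)"
      using less mono[OF _ S'(2)] by (meson less_le_trans)
    then show "x \<in> (\<Union>n. Z n)" using x by (auto simp: Z_def)
  next
    fix x assume "x \<in> (\<Union>n. Z n)"
    then obtain n where "x \<in> space M" "u x < (\<Sum>Q\<in>S' n. b Q * indicator Q x)"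
      by (auto simp: Z_def)
    then show "x \<in> {x\<in>space M. u x < (\<Sum>\<^sub>\<infinity>Q\<in>S. b Q * indicator Q x)}"
      unfolding sup less_SUP_iff using S' by blast
  qed
  show "{x\<in>space M. u x < (\<Sum>\<^sub>\<infinity>Q\<in>S. b Q * indicator Q x)} \<in> sets M"
    unfolding eq using Zm by auto
  have "emeasure M (\<Union>n. Z n) = (SUP n. emeasure M (Z n))"
    using Zm \<open>incseq Z\<close> by (intro SUP_emeasure_incseq[symmetric]) auto
  also have "\<dots> \<le> c"
    unfolding Z_def using S' by (intro SUP_least fin)
  finally show "emeasure M {x\<in>space M. u x < (\<Sum>\<^sub>\<infinity>Q\<in>S. b Q * indicator Q x)} \<le> c"
    unfolding eq .
qed

section \<open>The sparse bound\<close>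

theorem theorem4p4:
  fixes p \<epsilon> \<eta> :: real and m :: nat and v w :: "real^'n \<Rightarrow> real"
  assumes "0 < p" and "1 \<le> m" and "0 < \<eta>" and "\<eta> < 1"
    and "weight v" and "weight w"
    and "0 < \<epsilon>" and "\<epsilon> \<le> 1" and "\<epsilon> < p"
    and "muckenhoupt_infinity (\<lambda>x. w x * v x powr (- \<epsilon>))"
    and "RH_infinity_const w (\<lambda>x. v x powr (- \<epsilon>)) < top"
  shows "\<exists>C::real. 0 < C \<and>
    (\<forall>S f. sparse_family \<eta> S \<longrightarrow>
       (\<forall>i<m. f i \<in> borel_measurable lebesgue) \<longrightarrow>
       sparse_operator_defined m S f \<longrightarrow>
       weak_Lp_norm p w (\<lambda>x. sparse_operator m S f x / ereal (v x))
         \<le> ennreal C * weak_Lp_norm p w (\<lambda>x. maximal_operator m f x / ereal (v x)))"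
proof -
  define u where "u x = w x * v x powr (- \<epsilon>)" for x
  have vw [measurable]: "v \<in> borel_measurable lebesgue" "w \<in> borel_measurable lebesgue"
    and pos: "\<And>x. 0 < v x" "\<And>x. 0 < w x"
    using assms(5,6) by (auto simp: weight_def)
  have u: "muckenhoupt_infinity u" using assms(10) by (simp add: u_def[abs_def])
  then have uw: "weight u" by (auto simp: muckenhoupt_infinity_def muckenhoupt_def)
  let ?M = "density lebesgue (\<lambda>x. ennreal (w x))"
  have em: "emeasure ?M F = wmeas w F" if "F \<in> sets lebesgue" for F
    using vw(2) that by (rule wmeas_eq_emeasure_density)
  have nu: "(\<integral>\<^sup>+x\<in>F. ennreal (v x powr - \<epsilon>) \<partial>?M) = wmeas u F" if [measurable]: "F \<in> sets lebesgue" for F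
  proof -
    have "(\<integral>\<^sup>+x\<in>F. ennreal (v x powr - \<epsilon>) \<partial>?M)
        = (\<integral>\<^sup>+x. ennreal (w x) * (ennreal (v x powr - \<epsilon>) * indicator F x) \<partial>lebesgue)"
      by (rule nn_integral_density) auto
    also have "\<dots> = wmeas u F"
      unfolding wmeas_def u_def
      by (intro nn_integral_cong) (use pos(2) in \<open>simp add: ennreal_mult less_imp_le mult.assoc\<close>)
    finally show ?thesis .
  qed
  have uw': "weight (\<lambda>x. w x * v x powr (- \<epsilon>))" using uw by (simp add: u_def[abs_def])
  have vpow: "0 < v x powr (- \<epsilon>)" for x using pos(1)[of x] by simp
  obtain K0 where K0: "0 < K0" and rh: "\<And>Q F. is_cube Q \<Longrightarrow> F \<in> sets lebesgue \<Longrightarrow> F \<subseteq> Q \<Longrightarrow>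
      wmeas w Q * wmeas u F \<le> ennreal K0 * wmeas u Q * wmeas w F"
    by (rule RH_infinity_comparable[OF assms(6) uw' vpow assms(11), folded u_def]) (rule that)
  obtain C1 where C1: "0 < C1" and ainf: "\<And>Q E. is_cube Q \<Longrightarrow> E \<in> sets lebesgue \<Longrightarrow> E \<subseteq> Q \<Longrightarrow>
      \<eta> * measure lebesgue Q \<le> measure lebesgue E \<Longrightarrow> wmeas u Q \<le> ennreal C1 * wmeas u E"
    by (rule muckenhoupt_infinity_comparable[OF u assms(3)]) (rule that)
  obtain C3 where C3: "0 < C3" and triple: "\<And>Q E. is_cube Q \<Longrightarrow> E \<in> sets lebesgue \<Longrightarrow> E \<subseteq> Q \<Longrightarrow>
      1 / 3 ^ CARD('n) * measure lebesgue Q \<le> measure lebesgue E \<Longrightarrow> wmeas u Q \<le> ennreal C3 * wmeas u E"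
    by (rule muckenhoupt_infinity_comparable[OF u, of "1 / 3 ^ CARD('n)"]) (simp, rule that)
  define K D where "K = K0 * C1" and "D = K0 * C3"
  have KD: "0 < K" "0 < D" using K0 C1 C3 by (auto simp: K_def D_def)
  \<comment> \<open>\<open>u\<close> is doubling by \<open>A\<^sub>\<infinity>\<close>, and \<open>w\<close> inherits this through \<open>RH\<^sub>\<infinity>(w)\<close>\<close>
  have doubling: "wmeas w R \<le> ennreal D * wmeas w Q"
    if Q: "is_cube Q" and R: "is_cube R" and QR: "Q \<subseteq> R"
      and three: "measure lebesgue R = 3 ^ CARD('n) * measure lebesgue Q" for Q R :: "(real^'n) set"
  proof -
    note Qm = is_cube_lebesgue(1)[OF Q]
    have "wmeas w R * wmeas u Q \<le> ennreal K0 * wmeas u R * wmeas w Q" by (rule rh[OF R Qm QR])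
    also have "\<dots> \<le> ennreal K0 * (ennreal C3 * wmeas u Q) * wmeas w Q"
      using triple[OF R Qm QR] three by (intro mult_right_mono mult_left_mono) auto
    also have "\<dots> = (ennreal D * wmeas w Q) * wmeas u Q"
      using K0 C3 by (simp add: D_def ennreal_mult mult_ac)
    finally have "wmeas u Q * wmeas w R \<le> wmeas u Q * (ennreal D * wmeas w Q)"
      by (simp add: mult.commute)
    then show ?thesis
      using wmeas_cube[OF uw Q] by (subst (asm) ennreal_mult_le_mult_iff) auto
  qed
  define C0 where "C0 = absorption_const (p / \<epsilon>) K D"
  have C0: "0 < C0"
    unfolding C0_def using KD assms(7,9) by (intro absorption_const_pos) auto
  show ?thesis
  proof (intro exI[of _ "C0 powr (1 / p)"] conjI allI impI)
    show "0 < C0 powr (1 / p)" using C0 by simp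
    fix S :: "(real^'n) set set" and f :: "nat \<Rightarrow> real^'n \<Rightarrow> real"
    assume sparse: "sparse_family \<eta> S" and f: "\<forall>i<m. f i \<in> borel_measurable lebesgue"
    have cubes: "\<And>Q. Q \<in> S \<Longrightarrow> is_cube Q" using sparse by (simp add: sparse_family_def)
    obtain E where E: "\<And>Q. Q \<in> S \<Longrightarrow> E Q \<in> sets lebesgue" "\<And>Q. Q \<in> S \<Longrightarrow> E Q \<subseteq> Q"
        "\<And>Q. Q \<in> S \<Longrightarrow> \<eta> * measure lebesgue Q \<le> measure lebesgue (E Q)"
        "disjoint_family_on E S"
      using sparse unfolding sparse_family_def by blast
    let ?N = "weak_Lp_norm p w (\<lambda>x. maximal_operator m f x / ereal (v x))"
    show "weak_Lp_norm p w (\<lambda>x. sparse_operator m S f x / ereal (v x)) \<le> ennreal (C0 powr (1 / p)) * ?N"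
    proof (cases "?N = top")
      case True
      then show ?thesis using C0 by (simp add: ennreal_mult_top)
    next
      case False
      then obtain A where A: "?N = ennreal A" "0 \<le> A" by (cases ?N) auto
      have below_max: "{x. \<exists>Q. is_cube Q \<and> x \<in> Q \<and> ennreal (s * v x) < avg_prod m f Q}
          \<subseteq> {x. ereal s < \<bar>maximal_operator m f x / ereal (v x)\<bar>}" if s: "0 < s" for s
      proof clarify
        fix x Q assume Q: "is_cube Q" "x \<in> Q" "ennreal (s * v x) < avg_prod m f Q"
        have "ereal (s * v x) = enn2ereal (ennreal (s * v x))"
          using s pos(1)[of x] by simp
        also have "\<dots> < enn2ereal (avg_prod m f Q)" using Q(3) by (simp add: less_ennreal.rep_eq)
        also have "\<dots> \<le> maximal_operator m f x" by (rule maximal_operator_ge[OF Q(1,2)])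
        finally have less: "ereal (s * v x) < maximal_operator m f x" .
        then have "ereal s < maximal_operator m f x / ereal (v x)"
          using pos(1)[of x] by (cases "maximal_operator m f x") (auto simp: field_simps)
        then show "ereal s < \<bar>maximal_operator m f x / ereal (v x)\<bar>"
          by (rule less_le_trans) (cases "maximal_operator m f x / ereal (v x)"; simp)
      qed
      have tail: "wmeas w {x. \<exists>Q. is_cube Q \<and> x \<in> Q \<and> ennreal (s * v x) < avg_prod m f Q}
          \<le> ennreal (A powr p * s powr - p)" if "0 < s" for s
        using A assms(1) that by (intro weak_Lp_norm_tail[OF _ _ _ _ below_max]) auto
      \<comment> \<open>an infinite product of averages makes the maximal operator infinite on a cube, hence its norm infinite\<close>
      have finb: "avg_prod m f Q < top" if Q: "is_cube Q" for Q
      proof (rule ccontr)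
        assume "\<not> avg_prod m f Q < top"
        then have inf: "avg_prod m f Q = top" using less_top by blast
        have le: "wmeas w Q \<le> ennreal (A powr p * s powr - p)" if s: "0 < s" for s
        proof -
          have "Q \<subseteq> {x. \<exists>Q. is_cube Q \<and> x \<in> Q \<and> ennreal (s * v x) < avg_prod m f Q}"
            using Q inf by (auto intro!: exI[of _ Q])
          then show ?thesis using wmeas_mono tail[OF s] order_trans by blast
        qed
        obtain W where W: "wmeas w Q = ennreal W" "0 < W"
          using wmeas_cube[OF assms(6) Q] by (cases "wmeas w Q") auto
        have "W \<le> A powr p * s powr - p" if "0 < s" for s
          using le[OF that] W by simp
        \<comment> \<open>at this level the tail bound falls below \<open>W\<close>\<close>
        moreover define s where "s = ((A powr p + 1) / W) powr (1 / p)"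
        have d: "0 < A powr p + 1" by (simp add: add_nonneg_pos)
        ultimately have "W \<le> A powr p * s powr - p" using W by (simp add: s_def)
        also have "s powr - p = W / (A powr p + 1)"
          using W d assms(1) by (simp add: s_def powr_powr powr_minus_divide)
        also have "A powr p * (W / (A powr p + 1)) < W"
          using W d by (simp add: pos_divide_less_eq distrib_left mult.commute)
        finally show False by simp
      qed
      define b where "b Q = enn2real (avg_prod m f Q)" for Q
      have b: "avg_prod m f Q = ennreal (b Q)" "0 \<le> b Q" if "Q \<in> S" for Q
        using finb[OF cubes[OF that]] by (auto simp: b_def)
      have finite_bound: "emeasure ?M {x\<in>space ?M. ennreal (y * v x) < (\<Sum>Q\<in>F. avg_prod m f Q * indicator Q x)}
          \<le> ennreal (C0 * A powr p * y powr - p)"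
        if F: "finite F" "F \<subseteq> S" and y: "0 < y" for F y
      proof -
        let ?X = "{x\<in>space ?M. y * v x < (\<Sum>Q\<in>F. b Q * indicator Q x)}"
        have "ennreal (y powr p) * emeasure ?M ?X \<le> ennreal (absorption_const (p / \<epsilon>) K D * A powr p)"
        proof (rule sparse_sum_weak_type[where v = v and E = E])
          fix Q G assume Q: "Q \<in> F" and G: "G \<in> sets ?M" "G \<subseteq> Q"
          then have QS: "Q \<in> S" and Gm: "G \<in> sets lebesgue" using F by auto
          have "wmeas w Q * wmeas u G \<le> ennreal K0 * wmeas u Q * wmeas w G"
            by (rule rh[OF cubes[OF QS] Gm G(2)])
          also have "\<dots> \<le> ennreal K0 * (ennreal C1 * wmeas u (E Q)) * wmeas w G"
            using ainf[OF cubes[OF QS] E(1-3)[OF QS]] by (intro mult_right_mono mult_left_mono) auto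
          also have "\<dots> = ennreal K * wmeas u (E Q) * wmeas w G"
            using K0 C1 by (simp add: K_def ennreal_mult mult_ac)
          finally show "emeasure ?M Q * (\<integral>\<^sup>+x\<in>G. ennreal (v x powr - \<epsilon>) \<partial>?M)
              \<le> ennreal K * (\<integral>\<^sup>+x\<in>E Q. ennreal (v x powr - \<epsilon>) \<partial>?M) * emeasure ?M G"
            using is_cube_lebesgue(1)[OF cubes[OF QS]] Gm E(1)[OF QS] by (simp only: em nu)
        next
          fix T Y and t :: real
          assume T: "T \<subseteq> F" and Y: "Y \<in> sets ?M" "0 < t"
            and dense: "\<And>Q. Q \<in> T \<Longrightarrow> ennreal t * emeasure ?M Q \<le> emeasure ?M (Q \<inter> Y)"
          have Tc: "finite T" "\<And>Q. Q \<in> T \<Longrightarrow> is_cube Q"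
            using T F cubes finite_subset by auto
          have Ym: "Y \<in> sets lebesgue" using Y by simp
          have Tm: "Q \<in> sets lebesgue" if "Q \<in> T" for Q
            using is_cube_lebesgue(1)[OF Tc(2)[OF that]] .
          have "ennreal t * wmeas w (\<Union>T) \<le> ennreal D * wmeas w Y"
          proof (rule doubling_covering[OF vw(2) doubling Tc Ym])
            fix Q assume Q: "Q \<in> T"
            then show "ennreal t * wmeas w Q \<le> wmeas w (Q \<inter> Y)"
              using dense[OF Q] Tm[OF Q] Ym by (simp add: em)
          qed
          then show "ennreal t * emeasure ?M (\<Union>T) \<le> ennreal D * emeasure ?M Y"
            using Tc(1) Tm Ym by (subst (1 2) em) (auto intro: sets.finite_Union)
        next
          fix s :: real assume s: "0 < s"
          have "{x\<in>space ?M. \<exists>Q\<in>F. x \<in> Q \<and> s * v x < b Q}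
              \<subseteq> {x. \<exists>Q. is_cube Q \<and> x \<in> Q \<and> ennreal (s * v x) < avg_prod m f Q}"
          proof clarify
            fix x Q assume Q: "Q \<in> F" "x \<in> Q" "s * v x < b Q"
            then have "Q \<in> S" using F by auto
            then show "\<exists>Q. is_cube Q \<and> x \<in> Q \<and> ennreal (s * v x) < avg_prod m f Q"
              using Q cubes b s pos(1)[of x] by (intro exI[of _ Q]) (auto simp: ennreal_less_iff)
          qed
          then have "wmeas w {x\<in>space ?M. \<exists>Q\<in>F. x \<in> Q \<and> s * v x < b Q} \<le> ennreal (A powr p * s powr - p)"
            using wmeas_mono tail[OF s] order_trans by blast
          moreover have "{x\<in>space ?M. \<exists>Q\<in>F. x \<in> Q \<and> s * v x < b Q} \<in> sets lebesgue"
          proof -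
            have "{x\<in>space ?M. \<exists>Q\<in>F. x \<in> Q \<and> s * v x < b Q}
                = (\<Union>Q\<in>F. Q \<inter> {x\<in>space lebesgue. s * v x < b Q})" by auto
            also have "\<dots> \<in> sets lebesgue"
            proof (intro sets.finite_UN sets.Int)
              show "Q \<in> sets lebesgue" if "Q \<in> F" for Q
                using that F(2) cubes is_cube_lebesgue(1) by blast
              show "{x\<in>space lebesgue. s * v x < b Q} \<in> sets lebesgue" for Q
                by measurable
            qed (rule F(1))
            finally show ?thesis .
          qed
          ultimately show "emeasure ?M {x\<in>space ?M. \<exists>Q\<in>F. x \<in> Q \<and> s * v x < b Q}
              \<le> ennreal (A powr p * s powr - p)"
            by (simp only: em)
        next
          fix Q assume "Q \<in> F"
          then have Q: "is_cube Q" using F cubes by auto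
          show "Q \<in> sets ?M" using is_cube_lebesgue(1)[OF Q] by simp
          show "0 < emeasure ?M Q" "emeasure ?M Q < top"
            using em[OF is_cube_lebesgue(1)[OF Q]] wmeas_cube[OF assms(6) Q] by auto
        next
          show "disjoint_family_on E F" using E(4) F(2) by (rule disjoint_family_on_mono[rotated])
        qed (use assms KD A y F E b pos in auto)
        moreover have "{x\<in>space ?M. ennreal (y * v x) < (\<Sum>Q\<in>F. avg_prod m f Q * indicator Q x)} = ?X"
        proof (intro Collect_cong conj_cong refl)
          fix x
          have "(\<Sum>Q\<in>F. avg_prod m f Q * indicator Q x) = (\<Sum>Q\<in>F. ennreal (b Q * indicator Q x))"
            using F b by (intro sum.cong) (auto simp: indicator_def)
          also have "\<dots> = ennreal (\<Sum>Q\<in>F. b Q * indicator Q x)"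
            using F b by (intro sum_ennreal) auto
          finally show "ennreal (y * v x) < (\<Sum>Q\<in>F. avg_prod m f Q * indicator Q x)
              \<longleftrightarrow> y * v x < (\<Sum>Q\<in>F. b Q * indicator Q x)"
            using y pos(1)[of x] by (simp only: ennreal_less_iff mult_nonneg_nonneg less_imp_le)
        qed
        ultimately have "ennreal (y powr p) * emeasure ?M {x\<in>space ?M. ennreal (y * v x) < (\<Sum>Q\<in>F. avg_prod m f Q * indicator Q x)}
            \<le> ennreal (y powr p) * ennreal (C0 * A powr p * y powr - p)"
          using y C0 by (simp add: C0_def powr_minus field_simps flip: ennreal_mult)
        then show ?thesis
          using y by (subst (asm) ennreal_mult_le_mult_iff) auto
      qed
      have cnt: "countable S"
      proof (rule countable_disjoint_positive_measure[OF E(4) E(1)])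
        fix Q assume Q: "Q \<in> S"
        have "0 < \<eta> * measure lebesgue Q" using assms(3) is_cube_lebesgue(3)[OF cubes[OF Q]] by simp
        then have "measure lebesgue (E Q) \<noteq> 0" using E(3)[OF Q] by linarith
        then show "0 < emeasure lebesgue (E Q)" 
          by (metis Sigma_Algebra.measure_def enn2real_0 zero_less_iff_neq_zero)
      qed
      have "weak_Lp_norm p w (\<lambda>x. sparse_operator m S f x / ereal (v x))
          \<le> ennreal ((C0 * A powr p) powr (1 / p))"
      proof (rule weak_Lp_norm_leI)
        fix y :: real assume y: "0 < y"
        let ?Z = "{x\<in>space ?M. ennreal (y * v x) < (\<Sum>\<^sub>\<infinity>Q\<in>S. avg_prod m f Q * indicator Q x)}"
        have Z: "?Z \<in> sets ?M" "emeasure ?M ?Z \<le> ennreal (C0 * A powr p * y powr - p)"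
        proof -
          have "Q \<in> sets ?M" if "Q \<in> S" for Q
            using is_cube_lebesgue(1)[OF cubes[OF that]] by simp
          moreover have "(\<lambda>x. ennreal (y * v x)) \<in> borel_measurable ?M" by measurable
          ultimately show "?Z \<in> sets ?M" "emeasure ?M ?Z \<le> ennreal (C0 * A powr p * y powr - p)"
            using finite_families_suffice[OF cnt, of ?M "\<lambda>x. ennreal (y * v x)" "avg_prod m f"]
              finite_bound[OF _ _ y] by blast+
        qed
        have "{x. ereal y < \<bar>sparse_operator m S f x / ereal (v x)\<bar>} \<subseteq> ?Z"
        proof clarify
          fix x assume less: "ereal y < \<bar>sparse_operator m S f x / ereal (v x)\<bar>"
          have "ereal (y * v x) < \<bar>sparse_operator m S f x\<bar>"
            using less pos(1)[of x] by (cases "sparse_operator m S f x") (auto simp: field_simps)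
          also have "\<dots> \<le> enn2ereal (\<Sum>\<^sub>\<infinity>Q\<in>S. avg_prod m f Q * indicator Q x)"
            using cubes f by (intro abs_sparse_operator_le) auto
          finally have "enn2ereal (ennreal (y * v x)) < enn2ereal (\<Sum>\<^sub>\<infinity>Q\<in>S. avg_prod m f Q * indicator Q x)"
            using y pos(1)[of x] by simp
          then show "x \<in> space ?M \<and> ennreal (y * v x) < (\<Sum>\<^sub>\<infinity>Q\<in>S. avg_prod m f Q * indicator Q x)"
            by (simp add: less_ennreal.rep_eq)
        qed
        then have "wmeas w {x. ereal y < \<bar>sparse_operator m S f x / ereal (v x)\<bar>} \<le> wmeas w ?Z"
          by (rule wmeas_mono)
        also have "\<dots> \<le> ennreal (C0 * A powr p * y powr - p)"
          using Z by (subst em[symmetric]) auto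
        finally show "wmeas w {x. ereal y < \<bar>sparse_operator m S f x / ereal (v x)\<bar>}
            \<le> ennreal (C0 * A powr p * y powr - p)" .
      qed (use assms C0 in auto)
      also have "(C0 * A powr p) powr (1 / p) = C0 powr (1 / p) * A"
        using C0 A assms(1) by (simp add: powr_mult powr_powr)
      also have "ennreal (C0 powr (1 / p) * A) = ennreal (C0 powr (1 / p)) * ?N"
        using A by (simp add: ennreal_mult)
      finally show ?thesis .
    qed
  qed
qed

end
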